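(* Let $n>0$ and $k>3$ be two integers, and let $\psi\in(0,1)$ be a parameter. The graph $G$ over $[n]$ constructed as described in the context has $O\bigl((n/\psi^{1+1/(k-1)})\log n\bigr)$ edges. Furthermore, for a graph $H\sim\mathcal D(G,\psi)$, $H$ provides a straight path with at most $k$ hops for all pairs $i<j$ in $[n]$ except (in expectation) $O\bigl(kn/\psi^{1+1/(k-1)}\bigr)$ pairs. For all pairs $i,j$ with $j>i+\Omega\bigl(\psi^{-1-1/(k-1)}\log n\bigr)$, such a $k$-hop straight path exists in $H$ with high probability.
   Context: $[n]=\{1,\dots,n\}$. For a graph $G$ with vertex set $[n]$ and $i<j$, a straight path from $i$ to $j$ in $G$ is a path $i=i_1<i_2<\dots<i_m=j$ all of whose consecutive pairs are edges of $G$; its number of hops is its number of edges. $\mathcal D(G,\psi)$ is the distribution of the random subgraph of $G$ (same vertex set) in which each edge of $G$ is kept independently with probability $\psi$. "With high probability" means with probability at least $1-1/n^{O(1)}$. Construction of $G$ (a random graph). Let $c$ be a sufficiently large constant, and set $\nabla=1/\psi^{1/(k-1)}$, $b=O\bigl(\nabla\frac{c}{\psi}\ln n\bigr)$ and $L=(k+4)b$. (1) Connect every two vertices of $[n]$ at distance at most $L$ from each other. (2) Partition $[n]$ into consecutive blocks $B_1,\dots,B_{n/b}$ of size $b$, with $B_i=\{(i-1)b+1,\dots,ib\}$. Build the following graph whose vertices are the blocks, in their natural order: connect the median block to all the other blocks, and continue recursively on the blocks before the median and on the blocks after the median (so any two blocks are joined by a monotone path with at most 2 edges). Replace every edge $B_iB_j$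 of this block graph by a random connector, that is, a random bipartite graph obtained by picking each edge of the complete bipartite graph between $B_i$ and $B_j$ independently with the same probability, chosen so that the expected degree of a vertex in the connector is $O(\nabla/\psi)$. $G$ is the union of the edges from (1) and (2).
   Formalization: The bound on the number of edges of G is proved with high probability over the random connectors, and its O-constant may depend on k: step (1) alone gives about k·n·b edges, so the printed bound is false uniformly in k (e.g. ψ=1/2, k≈√n). *)

theory Defs
  imports "HOL-Probability.Probability"
begin

text \<open>A graph on the vertex set \<open>[n] = {1..n}\<close> is given by its set of edges, each edge being a
  two-element set \<open>{u, v}\<close>.\<close>

text \<open>The distribution \<open>\<D>(G, \<psi>)\<close>.\<close>

definition random_subgraph :: "nat set set \<Rightarrow> real \<Rightarrow> nat set set pmf" where
  "random_subgraph G \<psi> =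
     map_pmf (\<lambda>keep. {e \<in> G. keep e}) (Pi_pmf G False (\<lambda>_. bernoulli_pmf \<psi>))"

definition straight_path :: "nat set set \<Rightarrow> nat \<Rightarrow> nat \<Rightarrow> nat list \<Rightarrow> bool" where
  "straight_path G i j xs \<longleftrightarrow>
     xs \<noteq> [] \<and> hd xs = i \<and> last xs = j \<and> sorted_wrt (<) xs \<and>
     successively (\<lambda>u v. {u, v} \<in> G) xs"

definition hops :: "nat list \<Rightarrow> nat" where
  "hops xs = length xs - 1"

definition has_straight_path :: "nat set set \<Rightarrow> nat \<Rightarrow> nat \<Rightarrow> nat \<Rightarrow> bool" where
  "has_straight_path G k i j \<longleftrightarrow> (\<exists>xs. straight_path G i j xs \<and> hops xs \<le> k)"

definition nabla :: "nat \<Rightarrow> real \<Rightarrow> real" where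
  "nabla k \<psi> = 1 / \<psi> powr (1 / (real k - 1))"

text \<open>Here \<open>\<beta>\<close> is the constant hidden in \<open>b = O(\<nabla> (c / \<psi>) ln n)\<close>. The maximum with 1 matters only
  for \<open>n = 1\<close>, where \<open>ln n = 0\<close>.\<close>

definition block_size :: "nat \<Rightarrow> nat \<Rightarrow> real \<Rightarrow> real \<Rightarrow> real \<Rightarrow> nat" where
  "block_size n k \<psi> c \<beta> = max 1 (nat \<lceil>\<beta> * (nabla k \<psi> * (c / \<psi>) * ln (real n))\<rceil>)"

definition clique_range :: "nat \<Rightarrow> nat \<Rightarrow> nat" where
  "clique_range k b = (k + 4) * b"

definition near_edges :: "nat \<Rightarrow> nat \<Rightarrow> nat set set" where
  "near_edges n L = {{u, v} | u v. 1 \<le> u \<and> u < v \<and> v \<le> n \<and> v - u \<le> L}"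

text \<open>If \<open>b\<close> does not divide \<open>n\<close>, the last block is shorter.\<close>

definition num_blocks :: "nat \<Rightarrow> nat \<Rightarrow> nat" where
  "num_blocks n b = nat \<lceil>real n / real b\<rceil>"

definition block :: "nat \<Rightarrow> nat \<Rightarrow> nat \<Rightarrow> nat set" where
  "block n b i = {(i - 1) * b + 1 .. min (i * b) n}"

text \<open>\<open>median_graph lo hi\<close> is the set of edges \<open>(s, t)\<close>, \<open>s < t\<close>, of the recursively defined graph
  on \<open>{lo..<hi}\<close>. For an even number of vertices, the upper of the two middle ones is the median.\<close>

function median_graph :: "nat \<Rightarrow> nat \<Rightarrow> (nat \<times> nat) set" where
  "median_graph lo hi =
     (if hi \<le> lo then {}
      else let m = (lo + hi) div 2 in
        {(s, m) | s. lo \<le> s \<and> s < m} \<union> {(m, t) | t. m < t \<and> t < hi} \<union>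
        median_graph lo m \<union> median_graph (Suc m) hi)"
  by pat_completeness auto
termination by (relation "Wellfounded.measure (\<lambda>(lo, hi). hi - lo)") auto

declare median_graph.simps [simp del]

definition block_graph :: "nat \<Rightarrow> nat \<Rightarrow> (nat \<times> nat) set" where
  "block_graph n b = median_graph 1 (num_blocks n b + 1)"

definition complete_bipartite :: "nat set \<Rightarrow> nat set \<Rightarrow> nat set set" where
  "complete_bipartite A B = {{u, v} | u v. u \<in> A \<and> v \<in> B}"

text \<open>In a full block (of \<open>b\<close> vertices) this gives expected degree \<open>\<gamma> \<nabla> / \<psi>\<close>; so \<open>\<gamma>\<close> is the constant
  hidden in \<open>O(\<nabla> / \<psi>)\<close>. The minimum with 1 has no effect once \<open>c\<close> is large and \<open>n > 1\<close>.\<close>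

definition connector_prob :: "nat \<Rightarrow> real \<Rightarrow> real \<Rightarrow> nat \<Rightarrow> real" where
  "connector_prob k \<psi> \<gamma> b = min 1 (\<gamma> * (nabla k \<psi> / \<psi>) / real b)"

text \<open>The random connectors, chosen independently for the different edges of the block graph.\<close>

definition random_connectors ::
    "nat \<Rightarrow> nat \<Rightarrow> real \<Rightarrow> (nat \<times> nat \<Rightarrow> nat set set) pmf" where
  "random_connectors n b p =
     Pi_pmf (block_graph n b) {}
       (\<lambda>(s, t). random_subgraph (complete_bipartite (block n b s) (block n b t)) p)"

definition random_G :: "nat \<Rightarrow> nat \<Rightarrow> real \<Rightarrow> real \<Rightarrow> real \<Rightarrow> real \<Rightarrow> nat set set pmf" where
  "random_G n k \<psi> c \<beta> \<gamma> =
     (let b = block_size n k \<psi> c \<beta> in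
      map_pmf (\<lambda>R. near_edges n (clique_range k b) \<union> (\<Union>e \<in> block_graph n b. R e))
        (random_connectors n b (connector_prob k \<psi> \<gamma> b)))"

text \<open>\<open>H \<sim> \<D>(G, \<psi>)\<close>, with the randomness of both \<open>G\<close> and of the deletions.\<close>

definition random_H :: "nat \<Rightarrow> nat \<Rightarrow> real \<Rightarrow> real \<Rightarrow> real \<Rightarrow> real \<Rightarrow> nat set set pmf" where
  "random_H n k \<psi> c \<beta> \<gamma> = bind_pmf (random_G n k \<psi> c \<beta> \<gamma>) (\<lambda>G. random_subgraph G \<psi>)"

definition bad_pairs :: "nat \<Rightarrow> nat set set \<Rightarrow> nat \<Rightarrow> (nat \<times> nat) set" where
  "bad_pairs n H k =
     {(i, j). i \<in> {1..n} \<and> j \<in> {1..n} \<and> i < j \<and> \<not> has_straight_path H k i j}"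

end

theory Submission
  imports Defs
begin

text \<open>
  Over the randomness of both \<open>G\<close> and the deletions, the edges of \<open>H\<close> are independent: a near edge is
  present with probability \<open>\<psi>\<close>, any other potential connector edge with probability \<open>p \<psi>\<close>. To bound the probability that \<open>H\<close> has
  no straight path from \<open>i\<close> to \<open>j\<close>, choose layers of vertices between \<open>i\<close> and \<open>j\<close> and work backwards
  from \<open>j\<close>: if every subset \<open>X\<close> of a layer fails to reach \<open>j\<close> with probability at most
  \<open>exp (- a |X|) + \<epsilon>\<close>, then the Laplace transform of the number of neighbours of a set gives
  a bound of the same form for the preceding layer, in which \<open>a\<close> is multiplied by a quarter of the
  expected degree between the two layers (as long as \<open>a \<le> 1\<close>).

  If \<open>j\<close> is near \<open>i\<close>, the first and last layers have \<open>\<Theta>(s \<nabla> / \<psi>)\<close> vertices and the others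
  \<open>\<Theta>(\<nabla> / \<psi>)\<close>, and as few layers are used as make the final \<open>a\<close> reach \<open>s\<close>; this gives failure
  probability \<open>O(exp (- s))\<close>. If \<open>j\<close> is far, the layers are blocks, and two connector hops through
  a median block join the \<open>k - 2 \<ge> 2\<close> near hops. The expected number of paths then exceeds a large
  multiple of \<open>ln n\<close>, because \<open>k > 3\<close> leaves one logarithmic factor after the block size is paid for.
\<close>

section \<open>Random sets with independent elements\<close>

text \<open>Element-dependent probabilities let one form cover both graphs: in \<open>G\<close> near
  edges have probability 1 and other candidates \<open>p\<close>; in \<open>H\<close> these are
  multiplied by \<open>\<psi>\<close>.\<close>

definition random_edges :: "'a set \<Rightarrow> ('a \<Rightarrow> real) \<Rightarrow> 'a set pmf" where
  "random_edges E w =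
     map_pmf (\<lambda>keep. {e \<in> E. keep e}) (Pi_pmf E False (\<lambda>e. bernoulli_pmf (w e)))"

lemma random_subgraph_eq_random_edges: "random_subgraph G \<psi> = random_edges G (\<lambda>_. \<psi>)"
  by (simp add: random_subgraph_def random_edges_def)

lemma random_edges_empty [simp]: "random_edges {} w = return_pmf {}"
  by (simp add: random_edges_def)

lemma random_edges_insert:
  assumes "finite A" "e \<notin> A"
  shows "random_edges (insert e A) w =
    bind_pmf (bernoulli_pmf (w e))
      (\<lambda>x. map_pmf (\<lambda>H. if x then insert e H else H) (random_edges A w))"
proof -
  have *: "{e' \<in> insert e A. (f(e := y)) e'} = (if y then insert e {e' \<in> A. f e'} else {e' \<in> A. f e'})"
    for f y using assms(2) by auto
  show ?thesis
    unfolding random_edges_def Pi_pmf_insert[OF assms] pmf.map_comp o_def case_prod_unfold pair_pmf_def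
      map_bind_pmf map_return_pmf fst_conv snd_conv *
    by (simp only: map_pmf_def)
qed

lemma random_edges_cong:
  assumes "\<And>e. e \<in> E \<Longrightarrow> w e = w' e"
  shows "random_edges E w = random_edges E w'"
  unfolding random_edges_def by (intro arg_cong[where f = "map_pmf _"] Pi_pmf_cong) (use assms in auto)

lemma set_random_edges: "set_pmf (random_edges E w) \<subseteq> Pow E"
  by (auto simp: random_edges_def)

lemma finite_set_random_edges: "finite E \<Longrightarrow> finite (set_pmf (random_edges E w))"
  by (rule finite_subset[OF set_random_edges]) simp

text \<open>Independence in the form used below: disjoint edge sets may be exposed one after the
  other.\<close>

lemma random_edges_union:
  assumes "finite A" "finite B" "A \<inter> B = {}"
  shows "random_edges (A \<union> B) w =
    bind_pmf (random_edges A w) (\<lambda>H. map_pmf (\<lambda>H'. H \<union> H') (random_edges B w))"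
  using assms
proof (induction A rule: finite_induct)
  case empty
  have "map_pmf ((\<union>) {}) (random_edges B w) = random_edges B w"
    by (rule map_pmf_idI) simp
  then show ?case by (simp add: bind_return_pmf)
next
  case (insert e A)
  have "random_edges (insert e A \<union> B) w = bind_pmf (bernoulli_pmf (w e))
      (\<lambda>x. map_pmf (\<lambda>H. if x then insert e H else H) (random_edges (A \<union> B) w))"
    using insert by (subst Un_insert_left, subst random_edges_insert) auto
  also have "\<dots> = bind_pmf (random_edges (insert e A) w) (\<lambda>H. map_pmf (\<lambda>H'. H \<union> H') (random_edges B w))"
  proof -
    have ins: "(if x then insert e (H \<union> H') else H \<union> H') = (if x then insert e H else H) \<union> H'" for x H H'
      by simp
    have IH: "random_edges (A \<union> B) w = bind_pmf (random_edges A w) (\<lambda>H. map_pmf (\<lambda>H'. H \<union> H') (random_edges B w))"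
      using insert by auto
    show ?thesis
      unfolding IH random_edges_insert[OF insert.hyps]
      by (simp only: map_pmf_def bind_assoc_pmf bind_return_pmf ins)
  qed
  finally show ?case .
qed

text \<open>An element survives both rounds exactly when two independent coins succeed, so two
  rounds of sampling are one round with the product probabilities. Applied to all candidate edges,
  this makes the edges of \<open>H\<close> independent.\<close>

lemma random_edges_thin:
  assumes "finite A" "\<And>e. 0 \<le> w e \<and> w e \<le> 1" "\<And>e. 0 \<le> v e \<and> v e \<le> 1"
  shows "bind_pmf (random_edges A w) (\<lambda>R. random_edges R v) = random_edges A (\<lambda>e. w e * v e)"
  using assms(1)
proof (induction A rule: finite_induct)
  case empty
  then show ?case by (simp add: bind_return_pmf)
next
  case (insert e A)
  have bern: "bind_pmf (bernoulli_pmf (w e)) (\<lambda>x. if x then bernoulli_pmf (v e) else return_pmf False) =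
    bernoulli_pmf (w e * v e)"
  proof (rule pmf_eqI)
    fix b
    have "w e * v e \<le> 1" using assms(2,3)[of e] by (simp add: mult_le_one)
    then show "pmf (bind_pmf (bernoulli_pmf (w e)) (\<lambda>x. if x then bernoulli_pmf (v e) else return_pmf False)) b =
       pmf (bernoulli_pmf (w e * v e)) b"
      using assms(2,3)[of e] by (cases b) (simp_all add: pmf_bind algebra_simps)
  qed
  have "bind_pmf (random_edges (insert e A) w) (\<lambda>R. random_edges R v) =
    bind_pmf (bernoulli_pmf (w e)) (\<lambda>x. bind_pmf (random_edges A w)
      (\<lambda>R. random_edges (if x then insert e R else R) v))"
    using insert by (simp add: random_edges_insert bind_assoc_pmf bind_map_pmf)
  \<comment> \<open>An element rejected in the first round gets the constant coin
    \<open>False\<close>, so that both cases have the same shape and the coins of \<open>e\<close>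
    separate from those of \<open>A\<close>.\<close>
  also have "\<dots> = bind_pmf (bernoulli_pmf (w e)) (\<lambda>x. bind_pmf (random_edges A w)
      (\<lambda>R. bind_pmf (if x then bernoulli_pmf (v e) else return_pmf False) 
        (\<lambda>y. map_pmf (\<lambda>H. if y then insert e H else H) (random_edges R v))))"
  proof (intro bind_pmf_cong refl)
    fix x R assume "R \<in> set_pmf (random_edges A w)"
    then have "R \<subseteq> A" using set_random_edges by blast
    then have "finite R" "e \<notin> R" using insert finite_subset by auto
    then show "random_edges (if x then insert e R else R) v = 
       bind_pmf (if x then bernoulli_pmf (v e) else return_pmf False) 
        (\<lambda>y. map_pmf (\<lambda>H. if y then insert e H else H) (random_edges R v))"
      by (simp add: random_edges_insert bind_return_pmf)
  qed
  also have "\<dots> = bind_pmf (bernoulli_pmf (w e)) (\<lambda>x. 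
      bind_pmf (if x then bernoulli_pmf (v e) else return_pmf False) 
        (\<lambda>y. map_pmf (\<lambda>H. if y then insert e H else H) 
          (bind_pmf (random_edges A w) (\<lambda>R. random_edges R v))))"
    by (subst bind_commute_pmf) (simp add: map_bind_pmf)
  also have "\<dots> = bind_pmf (bernoulli_pmf (w e * v e)) 
        (\<lambda>y. map_pmf (\<lambda>H. if y then insert e H else H) (random_edges A (\<lambda>e. w e * v e)))"
    by (simp add: bind_assoc_pmf[symmetric] bern insert.IH)
  also have "\<dots> = random_edges (insert e A) (\<lambda>e. w e * v e)"
    using insert by (simp add: random_edges_insert)
  finally show ?case .
qed

section \<open>Expectations of functions of a random edge set\<close>

lemma expectation_bind_finite:
  fixes h :: "'b \<Rightarrow> real"
  assumes "finite (set_pmf p)" "\<And>x. x \<in> set_pmf p \<Longrightarrow> finite (set_pmf (f x))"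
  shows "measure_pmf.expectation (bind_pmf p f) h =
    measure_pmf.expectation p (\<lambda>x. measure_pmf.expectation (f x) h)"
  using assms
proof -
  have "measure_pmf.expectation (bind_pmf p f) h = (\<Sum>a\<in>set_pmf p. pmf p a *\<^sub>R measure_pmf.expectation (f a) h)"
    by (rule pmf_expectation_bind) (use assms in auto)
  also have "\<dots> = measure_pmf.expectation p (\<lambda>x. measure_pmf.expectation (f x) h)"
    by (rule integral_measure_pmf[symmetric]) (use assms in auto)
  finally show ?thesis .
qed

lemma prob_eq_expectation: "measure_pmf.prob p A = measure_pmf.expectation p (indicator A)"
  by simp

lemma expectation_random_edges_union:
  fixes h :: "'a set \<Rightarrow> real"
  assumes "finite A" "finite B" "A \<inter> B = {}"
  shows "measure_pmf.expectation (random_edges (A \<union> B) w) h =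
    measure_pmf.expectation (random_edges A w)
      (\<lambda>H. measure_pmf.expectation (random_edges B w) (\<lambda>H'. h (H \<union> H')))"
  unfolding random_edges_union[OF assms]
  by (subst expectation_bind_finite) (auto simp: finite_set_random_edges assms)

lemma expectation_mono_pmf:
  fixes f g :: "'a \<Rightarrow> real"
  assumes "finite (set_pmf p)" "\<And>x. x \<in> set_pmf p \<Longrightarrow> f x \<le> g x"
  shows "measure_pmf.expectation p f \<le> measure_pmf.expectation p g"
  by (rule integral_mono_AE) (use assms in \<open>simp_all add: AE_measure_pmf_iff integrable_measure_pmf_finite\<close>)

text \<open>Expose \<open>F\<close> first: an event closed under subsets can only be destroyed by
  the remaining edges. Having no short path is such an event, so edges that a proof does not follow
  may be dropped.\<close>

lemma prob_random_edges_antimono: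
  assumes "finite E" "F \<subseteq> E" "\<And>H H'. H \<subseteq> H' \<Longrightarrow> H' \<in> S \<Longrightarrow> H \<in> S"
  shows "measure_pmf.prob (random_edges E w) S \<le> measure_pmf.prob (random_edges F w) S"
proof -
  have fin: "finite F" "finite (E - F)" using assms finite_subset by auto
  have "measure_pmf.prob (random_edges E w) S = measure_pmf.expectation (random_edges (F \<union> (E - F)) w) (indicator S)"
    using assms(2) by (simp add: Un_absorb1)
  also have "\<dots> = measure_pmf.expectation (random_edges F w)
      (\<lambda>H. measure_pmf.expectation (random_edges (E - F) w) (\<lambda>H'. indicator S (H \<union> H')))"
    by (rule expectation_random_edges_union) (use fin in auto)
  also have "\<dots> \<le> measure_pmf.expectation (random_edges F w)
      (\<lambda>H. measure_pmf.expectation (random_edges (E - F) w) (\<lambda>H'. indicator S H))"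
    using fin assms(3) by (intro expectation_mono_pmf finite_set_random_edges) (auto simp: indicator_def intro: assms(3)[OF Un_upper1])
  also have "\<dots> = measure_pmf.prob (random_edges F w) S" by simp
  finally show ?thesis .
qed

text \<open>The probability generating function of a sum of independent indicators. It is used at
  \<open>z = 0\<close> for the absence of edges and at \<open>z = 2\<close> for the tail of the
  number of edges.\<close>

lemma expectation_random_edges_power_card:
  assumes "finite E" "\<And>e. e \<in> E \<Longrightarrow> 0 \<le> w e \<and> w e \<le> 1"
  shows "measure_pmf.expectation (random_edges E w) (\<lambda>H. z ^ card H) = (\<Prod>e\<in>E. 1 + (z - 1) * w e)"
  using assms
proof (induction E rule: finite_induct)
  case empty
  then show ?case by simp
next
  case (insert e A)
  have card: "z ^ card (if x then insert e H else H) = (if x then z else 1) * z ^ card H"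
    if "H \<in> set_pmf (random_edges A w)" for x H
  proof -
    have "H \<subseteq> A" using that set_random_edges by blast
    then have "finite H" "e \<notin> H" using insert.hyps finite_subset by auto
    then show ?thesis by simp
  qed
  have *: "measure_pmf.expectation (random_edges A w) (\<lambda>H. z ^ card (if x then insert e H else H)) =
      (if x then z else 1) * measure_pmf.expectation (random_edges A w) (\<lambda>H. z ^ card H)" for x
  proof -
    have "measure_pmf.expectation (random_edges A w) (\<lambda>H. z ^ card (if x then insert e H else H)) =
      measure_pmf.expectation (random_edges A w) (\<lambda>H. (if x then z else 1) * z ^ card H)"
      by (rule integral_cong_AE) (simp_all add: AE_measure_pmf_iff card)
    then show ?thesis by simp
  qed
  show ?case
    using insert
    by (simp add: random_edges_insert expectation_bind_finite finite_set_random_edges * algebra_simps)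
qed

lemma prob_random_edges_empty:
  assumes "finite E" "\<And>e. e \<in> E \<Longrightarrow> 0 \<le> w e \<and> w e \<le> 1"
  shows "measure_pmf.prob (random_edges E w) {{}} = (\<Prod>e\<in>E. 1 - w e)"
proof -
  have "measure_pmf.prob (random_edges E w) {{}} = measure_pmf.expectation (random_edges E w) (indicator {{}})"
    by (rule prob_eq_expectation)
  \<comment> \<open>Since \<open>0 ^ 0 = 1\<close>, the power \<open>0 ^ card H\<close> is the
    indicator of \<open>H = {}\<close> for finite \<open>H\<close>.\<close>
  also have "\<dots> = measure_pmf.expectation (random_edges E w) (\<lambda>H. 0 ^ card H)"
  proof (rule integral_cong_AE)
    show "AE H in measure_pmf (random_edges E w). indicator {{}} H = (0::real) ^ card H"
    proof (rule AE_pmfI)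
      fix H assume "H \<in> set_pmf (random_edges E w)"
      then have "H \<subseteq> E" using set_random_edges[of E w] by (rule_tac PowD) (rule subsetD)
      then have "finite H" using assms(1) by (rule finite_subset)
      then show "indicator {{}} H = (0::real) ^ card H"
        using zero_power[of "card H"] card_gt_0_iff[of H] by (cases "H = {}") (simp_all only: indicator_simps singleton_iff card.empty power_0, auto)
    qed
  qed (simp_all only: measurable_pmf_measure1 space_borel, auto)
  also have "\<dots> = (\<Prod>e\<in>E. 1 + (0 - 1) * w e)"
    using assms by (rule expectation_random_edges_power_card)
  also have "\<dots> = (\<Prod>e\<in>E. 1 - w e)"
    by (rule prod.cong[OF refl]) (simp only: diff_0 mult_minus1 add_uminus_conv_diff)
  finally show ?thesis .
qed

section \<open>Backward propagation through layers\<close>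

lemma expectation_cong_pmf:
  fixes f g :: "'a \<Rightarrow> real"
  assumes "\<And>x. x \<in> set_pmf p \<Longrightarrow> f x = g x"
  shows "measure_pmf.expectation p f = measure_pmf.expectation p g"
  by (rule integral_cong_AE) (use assms in \<open>simp_all add: AE_measure_pmf_iff\<close>)

lemma one_minus_exp_ge: 
  fixes y :: real
  assumes "0 \<le> y"
  shows "min 1 y / 2 \<le> 1 - exp (- y)"
proof -
  have "exp (- y) \<le> 1 / (1 + y)"
    using exp_ge_add_one_self[of y] assms by (simp add: exp_minus divide_simps)
  moreover have "min 1 y / 2 \<le> 1 - 1 / (1 + y)"
    using assms mult_left_le[of y y] by (auto simp: min_def field_simps)
  ultimately show ?thesis by linarith
qed

text \<open>Brings the Laplace bound back to an exponential in \<open>x\<close> plus an error. With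
  \<open>y = p * x\<close>, the factors \<open>1 - exp (- a)\<close> and
  \<open>1 - (1 - p) ^ x\<close> are at least \<open>min 1 a / 2\<close> and
  \<open>min 1 y / 2\<close>; the two summands of the bound are the cases \<open>y \<le> 1\<close>
  and \<open>y > 1\<close>.\<close>

lemma hit_bound:
  fixes a p :: real
  assumes "0 \<le> a" "0 \<le> p" "p \<le> 1"
  shows "(1 - (1 - exp (- a)) * (1 - (1 - p) ^ x)) ^ T
    \<le> exp (- (real T * p * min 1 a / 4) * real x) + exp (- (real T * min 1 a / 4))"
proof -
  define y where "y = p * real x"
  have y: "0 \<le> y" using assms by (simp add: y_def)
  have "(1 - p) ^ x \<le> exp (- p) ^ x"
    using exp_ge_add_one_self[of "- p"] assms by (intro power_mono) auto
  then have "1 - exp (- y) \<le> 1 - (1 - p) ^ x"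
    by (simp add: y_def exp_of_nat_mult[symmetric] mult.commute)
  then have 1: "min 1 y / 2 \<le> 1 - (1 - p) ^ x" using one_minus_exp_ge[OF y] by linarith
  have 2: "min 1 a / 2 \<le> 1 - exp (- a)" using one_minus_exp_ge assms by blast
  have "(min 1 a / 2) * (min 1 y / 2) \<le> (1 - exp (- a)) * (1 - (1 - p) ^ x)"
    by (intro mult_mono 1 2) (use assms y 1 2 in auto)
  then have "1 - (1 - exp (- a)) * (1 - (1 - p) ^ x) \<le> 1 + (- (min 1 a * min 1 y / 4))" by simp
  also have "\<dots> \<le> exp (- (min 1 a * min 1 y / 4))" by (rule exp_ge_add_one_self)
  finally have 3: "1 - (1 - exp (- a)) * (1 - (1 - p) ^ x) \<le> exp (- (min 1 a * min 1 y / 4))" .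
  have "(1 - exp (- a)) * (1 - (1 - p) ^ x) \<le> 1 * 1"
    using assms y 1 by (intro mult_mono) (auto simp: power_le_one)
  then have "(1 - (1 - exp (- a)) * (1 - (1 - p) ^ x)) ^ T \<le> exp (- (min 1 a * min 1 y / 4)) ^ T"
    by (intro power_mono 3) simp
  also have "\<dots> = exp (- (real T * min 1 a / 4) * min 1 y)"
    by (simp add: exp_of_nat_mult[symmetric] mult_ac)
  also have "\<dots> \<le> exp (- (real T * p * min 1 a / 4) * real x) + exp (- (real T * min 1 a / 4))"
  proof (cases "y \<le> 1")
    case True
    then have "- (real T * min 1 a / 4) * min 1 y = - (real T * p * min 1 a / 4) * real x"
      by (simp add: y_def mult_ac min_absorb2)
    then show ?thesis by (simp only:) simp
  next
    case False
    then show ?thesis by (simp add: min_def)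
  qed
  finally show ?thesis .
qed

lemma finite_complete_bipartite: "finite A \<Longrightarrow> finite B \<Longrightarrow> finite (complete_bipartite A B)"
  unfolding complete_bipartite_def by (rule finite_image_set2) simp_all

lemma prob_no_edge_to_le:
  assumes "finite X" "v \<notin> X" "0 \<le> p" "p \<le> 1" 
    "\<And>u. u \<in> X \<Longrightarrow> p \<le> w {u, v}" "\<And>e. 0 \<le> w e \<and> w e \<le> 1"
  shows "measure_pmf.prob (random_edges (complete_bipartite X {v}) w) {{}} \<le> (1 - p) ^ card X"
proof -
  have eq: "complete_bipartite X {v} = (\<lambda>u. {u, v}) ` X"
    by (auto simp: complete_bipartite_def)
  have inj: "inj_on (\<lambda>u. {u, v}) X" by (auto simp: inj_on_def doubleton_eq_iff)
  have "measure_pmf.prob (random_edges (complete_bipartite X {v}) w) {{}} = (\<Prod>e\<in>complete_bipartite X {v}. 1 - w e)"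
    by (rule prob_random_edges_empty) (use assms in \<open>simp_all add: finite_complete_bipartite\<close>)
  also have "\<dots> = (\<Prod>u\<in>X. 1 - w {u, v})"
    unfolding eq by (simp add: prod.reindex[OF inj])
  also have "\<dots> \<le> (\<Prod>u\<in>X. 1 - p)"
    by (rule prod_mono) (use assms in \<open>auto simp: algebra_simps\<close>)
  finally show ?thesis by simp
qed

text \<open>The candidate edges into distinct vertices of \<open>V\<close> are disjoint, so whether
  these vertices are hit is independent, and the Laplace transform of the number of hits is a
  product. Each vertex is missed with probability at most \<open>(1 - p) ^ card X\<close>.\<close>

lemma expectation_exp_neighbours_le:
  assumes "finite X" "finite V" "X \<inter> V = {}" "0 \<le> p" "p \<le> 1" "0 \<le> a"
    "\<And>u v. u \<in> X \<Longrightarrow> v \<in> V \<Longrightarrow> p \<le> w {u, v}" "\<And>e. 0 \<le> w e \<and> w e \<le> 1"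
  shows "measure_pmf.expectation (random_edges (complete_bipartite X V) w)
      (\<lambda>H. exp (- a * real (card {v \<in> V. \<exists>u\<in>X. {u, v} \<in> H})))
    \<le> (1 - (1 - exp (- a)) * (1 - (1 - p) ^ card X)) ^ card V"
  using assms(2,3,7)
proof (induction V rule: finite_induct)
  case empty
  then show ?case by (simp add: complete_bipartite_def)
next
  case (insert v V)
  let ?A = "complete_bipartite X {v}" and ?B = "complete_bipartite X V"
  let ?N = "\<lambda>V H. {v \<in> V. \<exists>u\<in>X. {u, v} \<in> H}"
  let ?c = "1 - (1 - exp (- a)) * (1 - (1 - p) ^ card X)"
  have un: "complete_bipartite X (insert v V) = ?A \<union> ?B" and disj: "?A \<inter> ?B = {}"
    using insert by (auto simp: complete_bipartite_def doubleton_eq_iff)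
  have fin: "finite ?A" "finite ?B"
    using assms(1) insert by (auto intro: finite_complete_bipartite)
  \<comment> \<open>The edges at \<open>v\<close> matter only through whether there are any.\<close>
  have split: "exp (- a * real (card (?N (insert v V) (H \<union> H')))) =
     (exp (- a) + (1 - exp (- a)) * indicator {{}} H) * exp (- a * real (card (?N V H')))"
    if "H \<in> set_pmf (random_edges ?A w)" "H' \<in> set_pmf (random_edges ?B w)" for H H'
  proof -
    have H: "H \<subseteq> ?A" "H' \<subseteq> ?B" using that set_random_edges by blast+
    have 1: "(\<exists>u\<in>X. {u, x} \<in> H \<union> H') \<longleftrightarrow> (\<exists>u\<in>X. {u, x} \<in> H')" if "x \<in> V" for x
      using that H insert by (auto simp: complete_bipartite_def doubleton_eq_iff subset_iff)
    have 2: "(\<exists>u\<in>X. {u, v} \<in> H \<union> H') \<longleftrightarrow> H \<noteq> {}"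
      using H insert by (fastforce simp: complete_bipartite_def doubleton_eq_iff subset_iff)
    have "?N (insert v V) (H \<union> H') = (if H = {} then ?N V H' else insert v (?N V H'))"
      using 1 2 by auto
    then have "real (card (?N (insert v V) (H \<union> H'))) = (if H = {} then 0 else 1) + real (card (?N V H'))"
      using insert.hyps by simp
    then show ?thesis by (simp add: algebra_simps exp_add[symmetric])
  qed
  have "measure_pmf.expectation (random_edges (complete_bipartite X (insert v V)) w)
      (\<lambda>H. exp (- a * real (card (?N (insert v V) H)))) = 
    measure_pmf.expectation (random_edges ?A w) (\<lambda>H. measure_pmf.expectation (random_edges ?B w)
      (\<lambda>H'. exp (- a * real (card (?N (insert v V) (H \<union> H'))))))"
    unfolding un by (rule expectation_random_edges_union) (use fin disj in auto)
  also have "\<dots> = measure_pmf.expectation (random_edges ?A w) (\<lambda>H. measure_pmf.expectation (random_edges ?B w)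
      (\<lambda>H'. (exp (- a) + (1 - exp (- a)) * indicator {{}} H) * exp (- a * real (card (?N V H')))))"
    by (intro expectation_cong_pmf) (simp only: split)
  also have "\<dots> = (exp (- a) + (1 - exp (- a)) * measure_pmf.prob (random_edges ?A w) {{}}) * 
     measure_pmf.expectation (random_edges ?B w) (\<lambda>H'. exp (- a * real (card (?N V H'))))"
    using fin by (simp add: integrable_measure_pmf_finite finite_set_random_edges)
  also have "\<dots> \<le> ?c * ?c ^ card V"
  proof (rule mult_mono)
    have "measure_pmf.prob (random_edges ?A w) {{}} \<le> (1 - p) ^ card X"
      using insert assms by (intro prob_no_edge_to_le) auto
    then have "(1 - exp (- a)) * measure_pmf.prob (random_edges ?A w) {{}} \<le> (1 - exp (- a)) * (1 - p) ^ card X"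
      using assms(6) by (intro mult_left_mono) auto
    then show "exp (- a) + (1 - exp (- a)) * measure_pmf.prob (random_edges ?A w) {{}} \<le> ?c"
      by (simp add: algebra_simps)
    have "(1 - exp (- a)) * (1 - (1 - p) ^ card X) \<le> 1 * 1"
      using assms by (intro mult_mono) (auto simp: power_le_one)
    then show "0 \<le> ?c" by simp
    show "measure_pmf.expectation (random_edges ?B w) (\<lambda>H'. exp (- a * real (card (?N V H')))) \<le> ?c ^ card V"
      using insert by auto
  qed (auto intro!: Bochner_Integration.integral_nonneg)
  finally show ?case using insert by simp
qed


text \<open>Only edges inside \<open>{t..}\<close> are exposed, so the edges from vertices below \<open>t\<close> are still independent
  of the event.\<close>

definition avoid_bound :: "nat set set \<Rightarrow> (nat set \<Rightarrow> real) \<Rightarrow> nat \<Rightarrow> nat \<Rightarrow> nat set \<Rightarrow> nat \<Rightarrow> real \<Rightarrow> real \<Rightarrow> bool" where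
  "avoid_bound E w j t V r a \<epsilon> \<longleftrightarrow> finite V \<and> V \<subseteq> {t..} \<and>
     (\<forall>X\<subseteq>V. measure_pmf.prob (random_edges {e \<in> E. e \<subseteq> {t..}} w) {H. \<forall>x\<in>X. \<not> has_straight_path H r x j}
        \<le> exp (- a * real (card X)) + \<epsilon>)"

lemma avoid_boundD:
  assumes "avoid_bound E w j t V r a \<epsilon>" "X \<subseteq> V"
  shows "measure_pmf.prob (random_edges {e \<in> E. e \<subseteq> {t..}} w) {H. \<forall>x\<in>X. \<not> has_straight_path H r x j}
        \<le> exp (- a * real (card X)) + \<epsilon>"
  using assms unfolding avoid_bound_def by (elim conjE allE[of _ X]) (rule mp)

lemma avoid_bound_weaken:
  assumes "avoid_bound E w j t V r a \<epsilon>" "a' \<le> a" "\<epsilon> \<le> \<epsilon>'" "V' \<subseteq> V"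
  shows "avoid_bound E w j t V' r a' \<epsilon>'"
proof -
  have *: "exp (- a * real (card X)) + \<epsilon> \<le> exp (- a' * real (card X)) + \<epsilon>'" for X :: "nat set"
    using assms by (intro add_mono) (simp_all add: mult_right_mono)
  show ?thesis
    unfolding avoid_bound_def
  proof (intro conjI allI impI)
    show "finite V'" using assms finite_subset[of V' V] by (simp add: avoid_bound_def)
    show "V' \<subseteq> {t..}" using assms by (auto simp: avoid_bound_def)
  next
    fix X assume "X \<subseteq> V'"
    then have "X \<subseteq> V" using assms(4) by (rule order_trans)
    then show "measure_pmf.prob (random_edges {e \<in> E. e \<subseteq> {t..}} w) {H. \<forall>x\<in>X. \<not> has_straight_path H r x j}
      \<le> exp (- a' * real (card X)) + \<epsilon>'"
      by (intro order_trans[OF avoid_boundD[OF assms(1)] *])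
  qed
qed

lemma prob_mono_support:
  assumes "\<And>x. x \<in> set_pmf p \<Longrightarrow> x \<in> A \<Longrightarrow> x \<in> B"
  shows "measure_pmf.prob p A \<le> measure_pmf.prob p B"
  by (rule measure_pmf.finite_measure_mono_AE) (use assms in \<open>auto simp: AE_measure_pmf_iff\<close>)

lemma has_straight_path_mono: "has_straight_path H r x y \<Longrightarrow> H \<subseteq> H' \<Longrightarrow> has_straight_path H' r x y"
  unfolding has_straight_path_def straight_path_def
  by (elim exE, intro exI) (auto intro: successively_mono)

lemma has_straight_path_more_hops: "has_straight_path H r i j \<Longrightarrow> r \<le> r' \<Longrightarrow> has_straight_path H r' i j"
  by (auto simp: has_straight_path_def)

lemma has_straight_path_edge: "u < v \<Longrightarrow> {u, v} \<in> H \<Longrightarrow> has_straight_path H 1 u v"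
  unfolding has_straight_path_def straight_path_def hops_def
  by (intro exI[of _ "[u, v]"]) simp

lemma has_straight_path_Cons:
  assumes "u < v" "{u, v} \<in> H" "has_straight_path H r v j"
  shows "has_straight_path H (Suc r) u j"
proof -
  obtain xs where xs: "straight_path H v j xs" "hops xs \<le> r"
    using assms(3) by (auto simp: has_straight_path_def)
  then obtain ys where ys: "xs = v # ys"
    by (cases xs) (auto simp: straight_path_def)
  have "straight_path H u j (u # xs)"
    using xs ys assms by (auto simp: straight_path_def)
  moreover have "hops (u # xs) \<le> Suc r" using xs ys by (simp add: hops_def)
  ultimately show ?thesis by (auto simp: has_straight_path_def)
qed

text \<open>The last hop: all edges from \<open>X\<close> to \<open>j\<close> must be absent, and
  \<open>1 - p \<le> exp (- p)\<close> gives the rate \<open>p\<close> without an error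
  term.\<close>

lemma avoid_bound_edge:
  assumes "finite E" "\<And>e. 0 \<le> w e \<and> w e \<le> 1" "0 \<le> p" "p \<le> 1" "V \<subseteq> {t..<j}"
    "\<And>u. u \<in> V \<Longrightarrow> {u, j} \<in> E \<and> p \<le> w {u, j}"
  shows "avoid_bound E w j t V 1 p 0"
  unfolding avoid_bound_def
proof (intro conjI allI impI)
  show "finite V" by (rule finite_subset[OF assms(5)]) simp
  show "V \<subseteq> {t..}" using assms(5) by auto
  fix X assume X: "X \<subseteq> V"
  let ?S = "{H. \<forall>x\<in>X. \<not> has_straight_path H 1 x j}"
  let ?K = "complete_bipartite X {j}"
  have fX: "finite X" by (rule finite_subset[OF order_trans[OF X assms(5)]]) simp
  have "measure_pmf.prob (random_edges {e \<in> E. e \<subseteq> {t..}} w) ?S \<le> measure_pmf.prob (random_edges ?K w) ?S"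
  proof (rule prob_random_edges_antimono)
    show "finite {e \<in> E. e \<subseteq> {t..}}" using assms(1) by simp
    show "?K \<subseteq> {e \<in> E. e \<subseteq> {t..}}"
      using X assms(5,6) by (fastforce simp: complete_bipartite_def)
  qed (auto dest: has_straight_path_mono)
  also have "\<dots> \<le> measure_pmf.prob (random_edges ?K w) {{}}"
  proof (rule prob_mono_support)
    fix H assume "H \<in> set_pmf (random_edges ?K w)" and S: "H \<in> ?S"
    then have "H \<subseteq> ?K" using set_random_edges by blast
    moreover have "{x, j} \<notin> H" if "x \<in> X" for x
      using S that X assms(5) has_straight_path_edge[of x j H] by auto
    ultimately show "H \<in> {{}}" by (auto simp: complete_bipartite_def)
  qed
  also have "\<dots> \<le> (1 - p) ^ card X"
    using assms X fX by (intro prob_no_edge_to_le) auto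
  also have "\<dots> \<le> exp (- p) ^ card X"
    using exp_ge_add_one_self[of "- p"] assms by (intro power_mono) auto
  also have "\<dots> = exp (- p * real (card X)) + 0"
    by (simp add: exp_of_nat_mult[symmetric] mult.commute)
  finally show "measure_pmf.prob (random_edges {e \<in> E. e \<subseteq> {t..}} w) ?S \<le> exp (- p * real (card X)) + 0" .
qed

text \<open>One hop backwards. Expose the edges between \<open>X\<close> and \<open>V\<close>; if
  \<open>X\<close> fails to reach \<open>j\<close>, all its neighbours in \<open>V\<close> fail with
  one hop less, and the known bound applies to them. Averaging over the first exposure leads to the
  Laplace transform of the number of neighbours.\<close>

lemma avoid_bound_step:
  assumes fin: "finite E" and w: "\<And>e. 0 \<le> w e \<and> w e \<le> 1" and p: "0 \<le> p" "p \<le> 1"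
    and av: "avoid_bound E w j t V r a \<epsilon>" and V': "V' \<subseteq> {t'..<t}" and t: "t' \<le> t"
    and edges: "\<And>u v. u \<in> V' \<Longrightarrow> v \<in> V \<Longrightarrow> {u, v} \<in> E \<and> p \<le> w {u, v}"
    and a: "0 \<le> a"
  shows "avoid_bound E w j t' V' (Suc r) (real (card V) * p * min 1 a / 4)
     (\<epsilon> + exp (- (real (card V) * min 1 a / 4)))"
  unfolding avoid_bound_def
proof (intro conjI allI impI)
  show "finite V'" by (rule finite_subset[OF V']) simp
  show "V' \<subseteq> {t'..}" using V' by auto
  fix X assume X: "X \<subseteq> V'"
  have V: "finite V" "V \<subseteq> {t..}" using av by (auto simp: avoid_bound_def)
  have fX: "finite X" by (rule finite_subset[OF order_trans[OF X V']]) simp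
  have XV: "X \<inter> V = {}" "\<And>x v. x \<in> X \<Longrightarrow> v \<in> V \<Longrightarrow> x < v" using X V V' by fastforce+
  let ?S = "{H. \<forall>x\<in>X. \<not> has_straight_path H (Suc r) x j}"
  let ?K = "complete_bipartite X V" and ?F = "{e \<in> E. e \<subseteq> {t..}}"
  let ?N = "\<lambda>H. {v \<in> V. \<exists>u\<in>X. {u, v} \<in> H}"
  have fin': "finite ?K" "finite ?F" using fin fX V by (simp_all add: finite_complete_bipartite)
  have "measure_pmf.prob (random_edges {e \<in> E. e \<subseteq> {t'..}} w) ?S \<le> measure_pmf.prob (random_edges (?K \<union> ?F) w) ?S"
  proof (rule prob_random_edges_antimono)
    show "finite {e \<in> E. e \<subseteq> {t'..}}" using fin by simp
    show "?K \<union> ?F \<subseteq> {e \<in> E. e \<subseteq> {t'..}}"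
    proof
      fix e assume "e \<in> ?K \<union> ?F"
      then show "e \<in> {e \<in> E. e \<subseteq> {t'..}}"
      proof
        assume "e \<in> ?K"
        then obtain u v where "e = {u, v}" "u \<in> X" "v \<in> V" by (auto simp: complete_bipartite_def)
        then show ?thesis using edges X V V' t by fastforce
      qed (use t in auto)
    qed
  qed (auto dest: has_straight_path_mono)
  also have "measure_pmf.prob (random_edges (?K \<union> ?F) w) ?S =
      measure_pmf.expectation (random_edges ?K w)
        (\<lambda>H. measure_pmf.expectation (random_edges ?F w) (\<lambda>H'. indicator ?S (H \<union> H')))"
    unfolding prob_eq_expectation
  proof (rule expectation_random_edges_union[OF fin'])
    \<comment> \<open>Every edge of \<open>?K\<close> has an end below \<open>t\<close> and every
      edge of \<open>?F\<close> lies in \<open>{t..}\<close>; hence the two exposures are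
      independent.\<close>
    have "x < t" if "x \<in> X" for x using that X V' by auto
    then show "?K \<inter> ?F = {}" by (force simp: complete_bipartite_def)
  qed
  also have "\<dots> \<le> measure_pmf.expectation (random_edges ?K w) (\<lambda>H. exp (- a * real (card (?N H))) + \<epsilon>)"
  proof (rule expectation_mono_pmf)
    fix H assume "H \<in> set_pmf (random_edges ?K w)"
    have "measure_pmf.expectation (random_edges ?F w) (\<lambda>H'. indicator ?S (H \<union> H')) \<le>
      measure_pmf.expectation (random_edges ?F w) (indicat_real {H'. \<forall>x\<in>?N H. \<not> has_straight_path H' r x j})"
    proof (rule expectation_mono_pmf)
      fix H'
      have "H' \<in> {H'. \<forall>x\<in>?N H. \<not> has_straight_path H' r x j}" if S: "H \<union> H' \<in> ?S"
      proof (clarify)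
        fix u v assume uv: "u \<in> X" "v \<in> V" "{u, v} \<in> H" and "has_straight_path H' r v j"
        then have "has_straight_path (H \<union> H') r v j" by (auto elim: has_straight_path_mono)
        then have "has_straight_path (H \<union> H') (Suc r) u j"
          using uv XV by (intro has_straight_path_Cons[of u v]) auto
        then show False using S uv by auto
      qed
      then show "indicat_real ?S (H \<union> H') \<le> indicat_real {H'. \<forall>x\<in>?N H. \<not> has_straight_path H' r x j} H'"
        by (simp only: indicator_def) (auto split: if_splits)
    qed (rule finite_set_random_edges[OF fin'(2)])
    also have "\<dots> \<le> exp (- a * real (card (?N H))) + \<epsilon>"
      unfolding prob_eq_expectation[symmetric]
      by (rule avoid_boundD[OF av]) simp
    finally show "measure_pmf.expectation (random_edges ?F w) (\<lambda>H'. indicator ?S (H \<union> H')) \<le>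
      exp (- a * real (card (?N H))) + \<epsilon>" .
  qed (rule finite_set_random_edges[OF fin'(1)])
  also have "\<dots> = measure_pmf.expectation (random_edges ?K w) (\<lambda>H. exp (- a * real (card (?N H)))) + \<epsilon>"
    using finite_set_random_edges[OF fin'(1)] by (simp add: integrable_measure_pmf_finite)
  also have "\<dots> \<le> (1 - (1 - exp (- a)) * (1 - (1 - p) ^ card X)) ^ card V + \<epsilon>"
    using expectation_exp_neighbours_le[OF fX V(1) XV(1) p a, of w] edges w X by (simp add: subset_iff)
  also have "\<dots> \<le> exp (- (real (card V) * p * min 1 a / 4) * real (card X)) +
     exp (- (real (card V) * min 1 a / 4)) + \<epsilon>"
    using hit_bound[OF a p] by simp
  finally show "measure_pmf.prob (random_edges {e \<in> E. e \<subseteq> {t'..}} w) ?S \<le>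
    exp (- (real (card V) * p * min 1 a / 4) * real (card X)) + (\<epsilon> + exp (- (real (card V) * min 1 a / 4)))"
    by simp
qed

lemma avoid_bound_prob:
  assumes "finite E" "avoid_bound E w j t V r a \<epsilon>" "i \<in> V"
  shows "measure_pmf.prob (random_edges E w) {H. \<not> has_straight_path H r i j} \<le> exp (- a) + \<epsilon>"
proof -
  have "measure_pmf.prob (random_edges E w) {H. \<not> has_straight_path H r i j} \<le>
    measure_pmf.prob (random_edges {e \<in> E. e \<subseteq> {t..}} w) {H. \<not> has_straight_path H r i j}"
    by (rule prob_random_edges_antimono) (use assms in \<open>auto dest: has_straight_path_mono\<close>)
  also have "\<dots> \<le> exp (- a) + \<epsilon>"
    using avoid_boundD[OF assms(2), of "{i}"] assms(3) by simp
  finally show ?thesis .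
qed

section \<open>Pairs at small distance\<close>

text \<open>The path goes from \<open>i\<close> into an interval of \<open>T1\<close> vertices,
  through \<open>M\<close> intervals of \<open>T2\<close> vertices, into an interval of
  \<open>T1\<close> vertices ending just before \<open>j\<close>, and then to \<open>j\<close>:
  \<open>M + 3\<close> hops. The outer intervals supply the factor \<open>s\<close>, the inner ones
  raise the rate by \<open>2 * D\<close> each. \<open>small\<close> keeps the rate below the cap 1
  before layer \<open>M\<close>, and \<open>large\<close> makes it at least \<open>1 / D\<close>
  there.\<close>

lemma prob_no_path_near:
  fixes \<psi> D s :: real
  assumes fin: "finite E" and w: "\<And>e. 0 \<le> w e \<and> w e \<le> 1"
    and \<psi>: "0 < \<psi>" "\<psi> < 1" and D: "1 \<le> D" and s: "1 \<le> s"
    and small: "\<And>r. r < M \<Longrightarrow> \<psi> * D\<^sup>2 * s * (2 * D) ^ r \<le> 1"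
    and large: "1 \<le> \<psi> * D\<^sup>2 * s * (2 * D) ^ M"
    and T1: "8 * s * D / \<psi> \<le> real T1" and T2: "8 * D / \<psi> \<le> real T2"
    and len: "i + 2 * T1 + M * T2 < j"
    and edges: "\<And>u v. i \<le> u \<Longrightarrow> u < v \<Longrightarrow> v \<le> j \<Longrightarrow> {u, v} \<in> E \<and> \<psi> \<le> w {u, v}"
  shows "measure_pmf.prob (random_edges E w) {H. \<not> has_straight_path H (M + 3) i j} \<le> 5 * exp (- s)"
proof -
  \<comment> \<open>\<open>D * a r\<close> is the quantity in \<open>small\<close> and
    \<open>large\<close>; the factor \<open>2 * D\<close> is a lower bound for
    \<open>T2 * \<psi> / 4\<close>.\<close>
  define a where "a r = \<psi> * D * s * (2 * D) ^ r" for r :: nat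
  \<comment> \<open>The initial error \<open>exp (- s)\<close> plus increments
    \<open>exp (- s) * (1 / 2) ^ r\<close>; it stays below \<open>3 * exp (- s)\<close> whatever
    \<open>M\<close> is.\<close>
  define \<epsilon> where "\<epsilon> r = exp (- s) * (3 - 2 * (1 / 2) ^ r)" for r :: nat
  have a_pos: "0 < a r" for r using \<psi> D s by (simp add: a_def)
  have sD: "s \<le> s * D" using s D mult_left_mono[of 1 D s] by simp
  have T1': "2 * s * D \<le> real T1 * \<psi> / 4" and T2': "2 * D \<le> real T2 * \<psi> / 4"
  proof -
    have "8 * (s * D) \<le> real T1 * \<psi>" using T1 \<psi> by (simp add: pos_divide_le_eq mult.assoc)
    then show "2 * s * D \<le> real T1 * \<psi> / 4" using sD s by simp
    have "8 * D \<le> real T2 * \<psi>" using T2 \<psi> by (simp add: pos_divide_le_eq)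
    then show "2 * D \<le> real T2 * \<psi> / 4" by simp
  qed
  \<comment> \<open>Position and length of the front interval stay free, so the same induction
    serves the \<open>T2\<close> intervals and the final \<open>T1\<close> interval.\<close>
  have layers: "avoid_bound E w j t {t..<t + T} (r + 2) (a r) (\<epsilon> r)"
    if "r \<le> M" "i \<le> t" "t + T + r * T2 + T1 \<le> j" for r t T
    using that
  proof (induction r arbitrary: t T)
    case 0
    define t0 where "t0 = j - T1"
    have t0: "t0 + T1 = j" "t + T \<le> t0" using 0 by (auto simp: t0_def)
    have base: "avoid_bound E w j t0 {t0..<j} 1 \<psi> 0"
      by (rule avoid_bound_edge) (use fin w \<psi> edges 0 t0 in auto)
    have card: "card {t0..<j} = T1" using t0 by simp
    have "avoid_bound E w j t {t..<t + T} (Suc 1) (real T1 * \<psi> * min 1 \<psi> / 4) (0 + exp (- (real T1 * min 1 \<psi> / 4)))"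
      using avoid_bound_step[OF fin w _ _ base, of \<psi> "{t..<t + T}" t] \<psi> t0 edges 0 card by auto
    then have "avoid_bound E w j t {t..<t + T} (Suc 1) (a 0) (\<epsilon> 0)"
    proof (rule avoid_bound_weaken)
      have "s * D * \<psi> \<le> real T1 * \<psi> / 4 * \<psi>"
        using T1' sD s \<psi> by (intro mult_right_mono) linarith+
      then have "a 0 \<le> (real T1 * \<psi> / 4) * \<psi>" by (simp add: a_def mult_ac)
      then show "a 0 \<le> real T1 * \<psi> * min 1 \<psi> / 4" using \<psi> by simp
      have "s \<le> real T1 * min 1 \<psi> / 4" using T1' sD s \<psi> by (simp only: min_absorb2[OF less_imp_le[OF \<psi>(2)]])
      then show "0 + exp (- (real T1 * min 1 \<psi> / 4)) \<le> \<epsilon> 0" by (simp add: \<epsilon>_def)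
    qed simp
    then show ?case by simp
  next
    case (Suc r)
    define t0 where "t0 = j - T1 - Suc r * T2"
    have t0: "t0 + T2 + r * T2 + T1 = j" "t + T \<le> t0" using Suc.prems by (auto simp: t0_def)
    have prev: "avoid_bound E w j t0 {t0..<t0 + T2} (r + 2) (a r) (\<epsilon> r)"
      by (rule Suc.IH) (use Suc.prems t0 in auto)
    have "a r * 1 \<le> a r * D" using a_pos[of r] D by (intro mult_left_mono) auto
    also have "a r * D \<le> 1" using small[of r] Suc.prems by (simp add: a_def power2_eq_square algebra_simps)
    finally have ar: "min 1 (a r) = a r" by simp
    have "avoid_bound E w j t {t..<t + T} (Suc (r + 2)) (real T2 * \<psi> * min 1 (a r) / 4) (\<epsilon> r + exp (- (real T2 * min 1 (a r) / 4)))"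
      using avoid_bound_step[OF fin w _ _ prev, of \<psi> "{t..<t + T}" t] \<psi> t0 edges Suc.prems a_pos[of r] by auto
    then have "avoid_bound E w j t {t..<t + T} (Suc (r + 2)) (a (Suc r)) (\<epsilon> (Suc r))"
    proof (rule avoid_bound_weaken)
      show "a (Suc r) \<le> real T2 * \<psi> * min 1 (a r) / 4"
        using mult_right_mono[OF T2', of "a r"] a_pos[of r] unfolding ar by (simp add: a_def algebra_simps)
      \<comment> \<open>Here the 2 in \<open>2 * D\<close> pays off: the exponent grows
        geometrically in \<open>r\<close> and leaves room for the factor
        \<open>(1 / 2) ^ r\<close>.\<close>
      have "s + real r * ln 2 \<le> 2 * s * 2 ^ r"
      proof -
        have "real r * ln 2 \<le> real r * 1" by (intro mult_left_mono) (use ln_2_less_1 in auto)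
        also have "\<dots> \<le> 2 ^ r * 1" using of_nat_less_two_power[of r] by (simp add: less_imp_le del: of_nat_less_two_power)
        also have "\<dots> \<le> 2 ^ r * s" using s by (intro mult_left_mono) auto
        finally have "real r * ln 2 \<le> s * 2 ^ r" by (simp add: mult.commute)
        moreover have "s * 1 \<le> s * 2 ^ r" using s by (intro mult_left_mono) auto
        ultimately show ?thesis by linarith
      qed
      also have "\<dots> \<le> 2 * s * (2 ^ r * (D ^ 2 * D ^ r))"
      proof -
        have "1 \<le> D ^ 2 * D ^ r" using one_le_power[OF D, of "2 + r"] by (simp only: power_add)
        then have "2 * s * 2 ^ r * 1 \<le> 2 * s * 2 ^ r * (D ^ 2 * D ^ r)" using s by (intro mult_left_mono) auto
        then show ?thesis by (simp add: mult_ac)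
      qed
      also have "\<dots> = 2 * D / \<psi> * a r" using \<psi> by (simp add: a_def power_mult_distrib power2_eq_square)
      also have "\<dots> \<le> real T2 / 4 * a r"
        using T2 a_pos[of r] by (intro mult_right_mono) auto
      finally have "- (real T2 * min 1 (a r) / 4) \<le> - s - real r * ln 2" unfolding ar by simp
      then have "exp (- (real T2 * min 1 (a r) / 4)) \<le> exp (- s - real r * ln 2)" by simp
      also have "\<dots> = exp (- s) * (1 / 2) ^ r"
        by (simp add: exp_diff exp_of_nat_mult power_one_over divide_simps)
      finally show "\<epsilon> r + exp (- (real T2 * min 1 (a r) / 4)) \<le> \<epsilon> (Suc r)"
        by (simp add: \<epsilon>_def algebra_simps)
    qed simp
    then show ?case by simp
  qed
  define t0 where "t0 = j - T1 - M * T2 - T1"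
  have t0: "t0 + T1 + M * T2 + T1 = j" "i < t0" using len by (auto simp: t0_def)
  have last: "avoid_bound E w j t0 {t0..<t0 + T1} (M + 2) (a M) (\<epsilon> M)"
    by (rule layers) (use t0 in auto)
  have step: "avoid_bound E w j i {i} (Suc (M + 2)) (real T1 * \<psi> * min 1 (a M) / 4) (\<epsilon> M + exp (- (real T1 * min 1 (a M) / 4)))"
    using avoid_bound_step[OF fin w _ _ last, of \<psi> "{i}" i] \<psi> t0 edges a_pos[of M] by auto
  \<comment> \<open>Since \<open>a M \<ge> 1 / D\<close>, the hop from \<open>i\<close> has rate at
    least \<open>2 * s * D * min 1 (a M) \<ge> s\<close>.\<close>
  have "1 \<le> D * a M" using large by (simp add: a_def power2_eq_square algebra_simps)
  then have "1 \<le> D * min 1 (a M)" using D by (simp add: min_def)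
  then have "s * 1 \<le> s * (D * min 1 (a M))" using s by (intro mult_left_mono) auto
  then have "s \<le> 2 * s * D * min 1 (a M)" using s by simp
  also have "\<dots> \<le> (real T1 * \<psi> / 4) * min 1 (a M)"
    using T1' a_pos[of M] by (intro mult_right_mono) auto
  finally have a': "s \<le> real T1 * \<psi> * min 1 (a M) / 4" by simp
  have "real T1 * \<psi> * min 1 (a M) / 4 \<le> real T1 * 1 * min 1 (a M) / 4"
    using \<psi> a_pos[of M] by (intro divide_right_mono mult_right_mono mult_left_mono) auto
  with a' have e': "s \<le> real T1 * min 1 (a M) / 4" by simp
  have "measure_pmf.prob (random_edges E w) {H. \<not> has_straight_path H (M + 3) i j} \<le>
    exp (- (real T1 * \<psi> * min 1 (a M) / 4)) + (\<epsilon> M + exp (- (real T1 * min 1 (a M) / 4)))"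
    using avoid_bound_prob[OF fin step] by (simp add: numeral_3_eq_3)
  also have "\<dots> \<le> exp (- s) + (exp (- s) * 3 + exp (- s))"
    using a' e' by (intro add_mono) (auto simp: \<epsilon>_def)
  finally show ?thesis by simp
qed

section \<open>Pairs at large distance\<close>

text \<open>Each hop multiplies \<open>\<psi> * D ^ e\<close> by \<open>D\<close> until the cap 1 is
  reached, and \<open>\<mu>\<close> records the surplus of the degree over \<open>D\<close>. Since
  \<open>D / \<psi> * min 1 (\<psi> * D ^ e) \<ge> 1\<close>, the added error is bounded by
  \<open>exp (- (l * \<kappa>))\<close> for every \<open>e\<close>.\<close>

lemma avoid_bound_dense_step:
  fixes \<psi> D \<kappa> l \<mu> p :: real
  assumes fin: "finite E" and w: "\<And>e. 0 \<le> w e \<and> w e \<le> 1"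
    and \<psi>: "0 < \<psi>" "\<psi> < 1" and D: "1 \<le> D" and \<kappa>: "0 \<le> \<kappa>" "\<kappa> \<le> 1"
    and l: "0 \<le> l" "4 * l * D / \<psi> \<le> real (card V)" and \<mu>: "\<mu> * D \<le> real (card V) * p / 4" "0 \<le> \<mu>"
    and p: "0 \<le> p" "p \<le> 1"
    and av: "avoid_bound E w j t V r (\<kappa> * min 1 (\<psi> * D ^ e)) \<epsilon>" and V': "V' \<subseteq> {t'..<t}" "t' \<le> t"
    and edges: "\<And>u v. u \<in> V' \<Longrightarrow> v \<in> V \<Longrightarrow> {u, v} \<in> E \<and> p \<le> w {u, v}"
  shows "avoid_bound E w j t' V' (Suc r) (\<mu> * \<kappa> * min 1 (\<psi> * D ^ Suc e)) (\<epsilon> + exp (- (l * \<kappa>)))"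
proof -
  let ?a = "\<kappa> * min 1 (\<psi> * D ^ e)"
  have a: "0 \<le> ?a" using \<kappa> \<psi> D by simp
  have "?a \<le> 1 * 1" using \<kappa> \<psi> D by (intro mult_mono) auto
  then have a1: "min 1 ?a = ?a" by simp
  have pow: "1 \<le> D ^ e" using D by simp
  have "avoid_bound E w j t' V' (Suc r) (real (card V) * p * min 1 ?a / 4)
     (\<epsilon> + exp (- (real (card V) * min 1 ?a / 4)))"
    by (rule avoid_bound_step[OF fin w p av V' edges a])
  then show ?thesis
  proof (rule avoid_bound_weaken)
    have "min 1 (\<psi> * D ^ Suc e) \<le> D * min 1 (\<psi> * D ^ e)"
      using D by (cases "\<psi> * D ^ e \<le> 1") (simp_all add: min_absorb2 min_absorb1 min.coboundedI1 min.coboundedI2)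
    then have "\<mu> * \<kappa> * min 1 (\<psi> * D ^ Suc e) \<le> \<mu> * \<kappa> * (D * min 1 (\<psi> * D ^ e))"
      using \<mu> \<kappa> by (intro mult_left_mono) auto
    also have "\<dots> = \<mu> * D * ?a" by simp
    also have "\<dots> \<le> real (card V) * p / 4 * ?a" using \<mu> a by (intro mult_right_mono) auto
    finally show "\<mu> * \<kappa> * min 1 (\<psi> * D ^ Suc e) \<le> real (card V) * p * min 1 ?a / 4"
      unfolding a1 by simp
    have "1 \<le> D / \<psi>" "1 \<le> D * D ^ e" using D \<psi> one_le_power[OF D, of "Suc e"] by (simp_all add: divide_simps)
    then have "1 \<le> D / \<psi> * min 1 (\<psi> * D ^ e)" using \<psi> by (simp add: min_def)
    then have "l * \<kappa> * 1 \<le> l * \<kappa> * (D / \<psi> * min 1 (\<psi> * D ^ e))" using l \<kappa> by (intro mult_left_mono) auto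
    also have "\<dots> = (l * D / \<psi>) * ?a" by simp
    also have "\<dots> \<le> (real (card V) / 4) * ?a" using l(2) a by (intro mult_right_mono) linarith+
    finally show "\<epsilon> + exp (- (real (card V) * min 1 ?a / 4)) \<le> \<epsilon> + exp (- (l * \<kappa>))"
      unfolding a1 by simp
  qed simp
qed

text \<open>Blocks are counted from 0. The path leaves block \<open>s\<close> for block
  \<open>s + e\<close>, moves block by block to \<open>s + k - 2\<close>, takes \<open>e\<close>
  connectors (1 or 2) to block \<open>\<tau>\<close>, and ends with a hop to \<open>j\<close> in the
  next block: \<open>1 + (k - 2 - e) + e + 1 = k\<close> hops. All but the last gain a factor
  \<open>D\<close>, which cancels the \<open>\<psi>\<close> of the last; each connector costs a
  factor \<open>\<kappa>\<close>, and the surplus \<open>l\<close> of the first hop remains.\<close>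

lemma prob_no_path_far:
  fixes \<psi> D \<gamma> l q :: real and b k s \<tau> :: nat
  defines "B \<equiv> \<lambda>x. {x * b + 1..<x * b + 1 + b}" and "\<kappa> \<equiv> min 1 (\<gamma> / 4)"
  assumes fin: "finite E" and w: "\<And>e. 0 \<le> w e \<and> w e \<le> 1"
    and \<psi>: "0 < \<psi>" "\<psi> < 1" and D: "1 \<le> D" and \<gamma>: "0 < \<gamma>"
    and l: "0 \<le> l" "4 * l * D / \<psi> \<le> real b" "1 \<le> l * \<kappa>\<^sup>2"
    and q: "0 \<le> q" "q \<le> 1" "real b * q = \<gamma> * D"
    and k: "3 < k" "1 \<le> \<psi> * D ^ (k - 1)"
    and i: "i \<in> B s" and j: "\<tau> * b + b < j" "j \<le> \<tau> * b + 2 * b" and \<tau>: "s + k - 2 < \<tau>"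
    and near: "\<And>u v. i \<le> u \<Longrightarrow> u < v \<Longrightarrow> v \<le> j \<Longrightarrow> v - u \<le> 3 * b \<Longrightarrow> {u, v} \<in> E \<and> \<psi> \<le> w {u, v}"
    and conn: "\<And>x y u v. R x y \<Longrightarrow> u \<in> B x \<Longrightarrow> v \<in> B y \<Longrightarrow> {u, v} \<in> E \<and> q \<le> w {u, v}"
    and R: "R (s + k - 2) \<tau> \<or> (\<exists>m. s + k - 2 < m \<and> m < \<tau> \<and> R (s + k - 2) m \<and> R m \<tau>)"
  shows "measure_pmf.prob (random_edges E w) {H. \<not> has_straight_path H k i j} \<le> real k * exp (- (l * \<kappa>\<^sup>2))"
proof -
  \<comment> \<open>Counted from \<open>j\<close>, the first of the \<open>h\<close> hops has no
    error term, hence \<open>h - 1\<close>.\<close>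
  let ?av = "\<lambda>x h K e. avoid_bound E w j (x * b + 1) (B x) h (K * min 1 (\<psi> * D ^ e)) (real (h - 1) * exp (- (l * \<kappa>\<^sup>2)))"
  have \<kappa>: "0 < \<kappa>" "\<kappa> \<le> 1" "\<kappa> \<le> \<gamma> / 4"
    using \<gamma> by (simp_all add: \<kappa>_def)
  then have \<kappa>2: "\<kappa>\<^sup>2 \<le> \<kappa>" "\<kappa>\<^sup>2 \<le> 1"
    by (simp_all add: power2_eq_square mult_left_le mult_le_one)
  have cardB [simp]: "card (B x) = b" for x by (simp add: B_def)
  have block_le: "x * b + b \<le> y * b" if "x < y" for x y
    using mult_le_mono1[of "Suc x" y b] that by simp
  have exp_le: "exp (- (l * K)) \<le> exp (- (l * \<kappa>\<^sup>2))" if "\<kappa>\<^sup>2 \<le> K" for K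
    using that l by (simp add: mult_left_mono)
  have near_deg: "l * D \<le> real b * \<psi> / 4" using l \<psi> by (simp add: field_simps)
  have base: "?av \<tau> 1 1 0"
  proof -
    have "avoid_bound E w j (\<tau> * b + 1) (B \<tau>) 1 \<psi> 0"
    proof (rule avoid_bound_edge)
      fix u assume "u \<in> B \<tau>"
      moreover have "s < \<tau>" using \<tau> k(1) by simp
      then have "i \<le> \<tau> * b" using i block_le[of s \<tau>] by (auto simp: B_def)
      ultimately show "{u, j} \<in> E \<and> \<psi> \<le> w {u, j}" using j by (intro near) (auto simp: B_def)
    qed (use fin w \<psi> j in \<open>auto simp: B_def\<close>)
    then show ?thesis using \<psi> by simp
  qed
  \<comment> \<open>\<open>b * q / 4 = \<gamma> * D / 4\<close> is at least
    \<open>\<kappa> * D\<close>, so a connector hop costs only the constant factor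
    \<open>\<kappa>\<close>.\<close>
  have connector: "?av x (Suc h) (\<kappa> * K) (Suc e)"
    if "?av y h K e" "R x y" "x < y" "\<kappa>\<^sup>2 \<le> K" "K \<le> 1" "1 \<le> h" for x y h K e
  proof -
    have "0 \<le> K" using that(4) zero_le_power2[of \<kappa>] by linarith
    have "avoid_bound E w j (x * b + 1) (B x) (Suc h) (\<kappa> * K * min 1 (\<psi> * D ^ Suc e))
       (real (h - 1) * exp (- (l * \<kappa>\<^sup>2)) + exp (- (l * K)))"
    proof (rule avoid_bound_dense_step[OF fin w \<psi> D \<open>0 \<le> K\<close> that(5) l(1) _ _ _ q(1,2) that(1)])
      show "\<kappa> * D \<le> real (card (B y)) * q / 4"
        using mult_right_mono[OF \<kappa>(3), of D] D q(3) by simp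
      show "B x \<subseteq> {x * b + 1..<y * b + 1}" using block_le[OF that(3)] by (auto simp: B_def)
      show "x * b + 1 \<le> y * b + 1" using block_le[OF that(3)] by linarith
    qed (use l \<kappa> conn[OF that(2)] in auto)
    then show ?thesis
    proof (rule avoid_bound_weaken)
      show "real (h - 1) * exp (- (l * \<kappa>\<^sup>2)) + exp (- (l * K)) \<le> real (Suc h - 1) * exp (- (l * \<kappa>\<^sup>2))"
        using exp_le[OF that(4)] that(6) by (simp add: of_nat_diff algebra_simps)
    qed simp_all
  qed
  have hop: "avoid_bound E w j t V (Suc h) (l * \<kappa>\<^sup>2 * min 1 (\<psi> * D ^ Suc e)) (real h * exp (- (l * \<kappa>\<^sup>2)))"
    if "?av y h (\<kappa>\<^sup>2) e" "1 \<le> h" "V \<subseteq> {t..<y * b + 1}" "i \<le> t" "y * b + b \<le> t + 3 * b" "t \<le> y * b + 1" "y < \<tau>"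
    for t V y h e
  proof -
    have "avoid_bound E w j t V (Suc h) (l * \<kappa>\<^sup>2 * min 1 (\<psi> * D ^ Suc e))
       (real (h - 1) * exp (- (l * \<kappa>\<^sup>2)) + exp (- (l * \<kappa>\<^sup>2)))"
    proof (rule avoid_bound_dense_step[OF fin w \<psi> D _ _ l(1) _ _ _ _ _ that(1,3)])
      fix u v assume "u \<in> V" "v \<in> B y"
      then show "{u, v} \<in> E \<and> \<psi> \<le> w {u, v}"
        using that j block_le[OF that(7)] by (intro near) (auto simp: B_def subset_iff)
    qed (use l \<kappa> \<kappa>2 \<psi> near_deg that in auto)
    then show ?thesis
      by (rule avoid_bound_weaken) (use that in \<open>simp_all add: of_nat_diff algebra_simps\<close>)
  qed
  \<comment> \<open>Here \<open>e\<close> is the number of connector hops; one more near hop replaces a missing second connector.\<close>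
  have finish: ?thesis if start: "?av (s + k - 2) (Suc e) (\<kappa>\<^sup>2) e" and e: "1 \<le> e" "e \<le> 2" for e
  proof -
    have chain: "?av (s + k - 2 - r) (Suc e + r) (\<kappa>\<^sup>2) (e + r)" if "r \<le> k - 3" for r
      using that
    proof (induction r)
      case 0
      then show ?case using start by simp
    next
      case (Suc r)
      let ?y = "s + k - 2 - r"
      have y: "s + k - 2 - Suc r < ?y" "s < s + k - 2 - Suc r" "?y < \<tau>" "?y = Suc (s + k - 2 - Suc r)"
        using Suc.prems k \<tau> by auto
      have "avoid_bound E w j ((s + k - 2 - Suc r) * b + 1) (B (s + k - 2 - Suc r)) (Suc (Suc e + r))
        (l * \<kappa>\<^sup>2 * min 1 (\<psi> * D ^ Suc (e + r))) (real (Suc e + r) * exp (- (l * \<kappa>\<^sup>2)))"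
      proof (rule hop)
        show "?av ?y (Suc e + r) (\<kappa>\<^sup>2) (e + r)" using Suc by simp
        show "B (s + k - 2 - Suc r) \<subseteq> {(s + k - 2 - Suc r) * b + 1..<?y * b + 1}"
          using block_le[OF y(1)] by (auto simp: B_def)
        show "i \<le> (s + k - 2 - Suc r) * b + 1" using i block_le[OF y(2)] by (auto simp: B_def)
        show "?y * b + b \<le> (s + k - 2 - Suc r) * b + 1 + 3 * b" unfolding y(4) by simp
        show "(s + k - 2 - Suc r) * b + 1 \<le> ?y * b + 1" unfolding y(4) by simp
      qed (use y in auto)
      \<comment> \<open>The surplus \<open>l\<close> of this hop is given up to return to the
        constant \<open>\<kappa>\<^sup>2\<close>, because the next step needs a constant at most
        1.\<close>
      then have "avoid_bound E w j ((s + k - 2 - Suc r) * b + 1) (B (s + k - 2 - Suc r)) (Suc (Suc e + r))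
        (\<kappa>\<^sup>2 * min 1 (\<psi> * D ^ (e + Suc r))) (real (Suc e + r) * exp (- (l * \<kappa>\<^sup>2)))"
      proof (rule avoid_bound_weaken)
        have "\<kappa>\<^sup>2 \<le> l * \<kappa>\<^sup>2" using l(3) \<kappa>2 by linarith
        then show "\<kappa>\<^sup>2 * min 1 (\<psi> * D ^ (e + Suc r)) \<le> l * \<kappa>\<^sup>2 * min 1 (\<psi> * D ^ Suc (e + r))"
          using \<psi> D by (simp add: mult_right_mono)
      qed simp_all
      then show ?case by simp
    qed
    \<comment> \<open>Stopping at block \<open>s + e\<close> makes the hop count exactly
      \<open>k\<close>. With two connectors the hop from \<open>i\<close> skips a block, which is
      why near edges of length up to \<open>3 * b\<close> are required.\<close>
    let ?r = "k - 2 - e"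
    let ?y = "s + k - 2 - ?r"
    have y: "?y = s + e" using k e by auto
    have "avoid_bound E w j i {i} (Suc (Suc e + ?r)) (l * \<kappa>\<^sup>2 * min 1 (\<psi> * D ^ Suc (e + ?r))) (real (Suc e + ?r) * exp (- (l * \<kappa>\<^sup>2)))"
    proof (rule hop)
      show "?av ?y (Suc e + ?r) (\<kappa>\<^sup>2) (e + ?r)" using chain[of ?r] e by simp
      have "i \<le> s * b + b" "s * b + b \<le> (s + e) * b" "s * b + 1 \<le> i" using i block_le[of s "s + e"] e by (auto simp: B_def)
      then show "{i} \<subseteq> {i..<?y * b + 1}" "i \<le> ?y * b + 1" unfolding y by auto
      have "(s + e) * b \<le> (s + 2) * b" using e by (intro mult_le_mono1) simp
      then show "?y * b + b \<le> i + 3 * b" unfolding y using \<open>s * b + 1 \<le> i\<close> by simp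
      show "?y < \<tau>" unfolding y using \<tau> k e by simp
    qed auto
    moreover have "Suc (Suc e + ?r) = k" "Suc (e + ?r) = k - 1" using k e by auto
    moreover have "Suc e + ?r = k - 1" using k e by auto
    ultimately have "avoid_bound E w j i {i} k (l * \<kappa>\<^sup>2 * min 1 (\<psi> * D ^ (k - 1))) (real (k - 1) * exp (- (l * \<kappa>\<^sup>2)))"
      by (simp only:)
    \<comment> \<open>After \<open>k - 1\<close> gains the minimum is 1. The final rate contributes
      one more \<open>exp (- (l * \<kappa>\<^sup>2))\<close>, hence \<open>k\<close> of
      them.\<close>
    then have "avoid_bound E w j i {i} k (l * \<kappa>\<^sup>2) (real (k - 1) * exp (- (l * \<kappa>\<^sup>2)))"
      using k(2) by simp
    from avoid_bound_prob[OF fin this] show ?thesis using k(1) by (simp add: of_nat_diff algebra_simps)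
  qed
  show ?thesis
    using R
  proof (elim disjE exE conjE)
    assume "R (s + k - 2) \<tau>"
    then have "?av (s + k - 2) (Suc 1) (\<kappa> * 1) (Suc 0)"
      using \<tau> \<kappa>2 by (intro connector[OF base]) auto
    \<comment> \<open>With a single connector one factor \<open>\<kappa>\<close> is given away, so
      that both cases continue alike.\<close>
    then have "?av (s + k - 2) (Suc 1) (\<kappa>\<^sup>2) 1"
    proof (rule avoid_bound_weaken)
      show "\<kappa>\<^sup>2 * min 1 (\<psi> * D ^ 1) \<le> \<kappa> * 1 * min 1 (\<psi> * D ^ Suc 0)"
        using \<kappa>2 \<psi> D by (simp add: mult_right_mono)
    qed simp_all
    then show ?thesis by (rule finish) auto
  next
    fix m assume m: "s + k - 2 < m" "m < \<tau>" "R (s + k - 2) m" "R m \<tau>"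
    have "?av m (Suc 1) (\<kappa> * 1) (Suc 0)"
      using m \<kappa>2 by (intro connector[OF base]) auto
    then have "?av (s + k - 2) (Suc (Suc 1)) (\<kappa> * (\<kappa> * 1)) (Suc (Suc 0))"
      by (rule connector) (use m \<kappa> \<kappa>2 in auto)
    then have "?av (s + k - 2) (Suc 2) (\<kappa>\<^sup>2) 2" by (simp add: power2_eq_square numeral_2_eq_2)
    then show ?thesis by (rule finish) auto
  qed
qed

section \<open>The random graphs\<close>

lemma median_graph_less: "(s, t) \<in> median_graph lo hi \<Longrightarrow> lo \<le> s \<and> s < t \<and> t < hi"
proof (induction lo hi rule: median_graph.induct)
  case (1 lo hi)
  show ?case
  proof (cases "hi \<le> lo")
    case True
    then show ?thesis using 1(3) by (simp add: median_graph.simps[of lo hi])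
  next
    case False
    define m where "m = (lo + hi) div 2"
    have m: "lo \<le> m" "m < hi" using False by (auto simp: m_def)
    note IH = 1(1)[OF False m_def] 1(2)[OF False m_def]
    have "(s, t) \<in> {(s, m) | s. lo \<le> s \<and> s < m} \<union> {(m, t) | t. m < t \<and> t < hi} \<union>
        median_graph lo m \<union> median_graph (Suc m) hi"
      using 1(3) False unfolding median_graph.simps[of lo hi] by (simp add: Let_def m_def)
    then show ?thesis using IH m by fastforce
  qed
qed

text \<open>Follow the recursion to the first median \<open>m\<close> with
  \<open>s \<le> m \<le> t\<close>: it belongs to the same part as \<open>s\<close> and
  \<open>t\<close>, hence is adjacent to each of them that differs from it.\<close>

lemma median_graph_two_hops:
  assumes "lo \<le> s" "s < t" "t < hi"
  shows "(s, t) \<in> median_graph lo hi \<or>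
    (\<exists>m. s < m \<and> m < t \<and> (s, m) \<in> median_graph lo hi \<and> (m, t) \<in> median_graph lo hi)"
  using assms
proof (induction lo hi rule: median_graph.induct)
  case (1 lo hi)
  have False': "\<not> hi \<le> lo" using 1 by simp
  define m where "m = (lo + hi) div 2"
  note IH = 1(1)[OF False' m_def] 1(2)[OF False' m_def]
  have eq: "median_graph lo hi = {(s, m) | s. lo \<le> s \<and> s < m} \<union> {(m, t) | t. m < t \<and> t < hi} \<union>
        median_graph lo m \<union> median_graph (Suc m) hi"
    using False' unfolding median_graph.simps[of lo hi] by (simp add: Let_def m_def)
  consider "t < m" | "s \<ge> Suc m" | "s \<le> m" "m \<le> t" by linarith
  then show ?case
  proof cases
    case 1
    then show ?thesis using IH(1) \<open>lo \<le> s\<close> \<open>s < t\<close> unfolding eq by blast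
  next
    case 2
    then show ?thesis using IH(2) \<open>s < t\<close> \<open>t < hi\<close> unfolding eq by blast
  next
    case 3
    show ?thesis
    proof (cases "s = m \<or> t = m")
      case True
      then show ?thesis using \<open>lo \<le> s\<close> \<open>s < t\<close> \<open>t < hi\<close> unfolding eq by auto
    next
      case False
      then show ?thesis using 3 \<open>lo \<le> s\<close> \<open>t < hi\<close> unfolding eq by (intro disjI2 exI[of _ m]) auto
    qed
  qed
qed

lemma finite_median_graph: "finite (median_graph lo hi)"
  by (rule finite_subset[of _ "{..hi} \<times> {..hi}"]) (auto dest: median_graph_less)

text \<open>A part with \<open>v > 0\<close> vertices contributes \<open>v - 1\<close> edges at its
  median, so each level of the recursion adds at most \<open>hi - lo - 1\<close> edges. Halving the
  parts bounds the number of levels by \<open>r\<close>.\<close>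

lemma card_median_graph_le: "hi - lo < 2 ^ r \<Longrightarrow> card (median_graph lo hi) \<le> r * (hi - lo - 1)"
proof (induction lo hi arbitrary: r rule: median_graph.induct)
  case (1 lo hi)
  show ?case
  proof (cases "hi \<le> lo")
    case True
    then show ?thesis by (simp add: median_graph.simps[of lo hi])
  next
    case False
    then obtain q where r: "r = Suc q" using 1(3) by (cases r) auto
    define m where "m = (lo + hi) div 2"
    have m: "lo \<le> m" "m < hi" using False by (auto simp: m_def)
    have sizes: "m - lo < 2 ^ q" "hi - Suc m < 2 ^ q" using 1(3) False by (auto simp: r m_def)
    note IH = 1(1)[OF False m_def sizes(1)] 1(2)[OF False m_def sizes(2)]
    have eq: "median_graph lo hi = ({(s, m) | s. lo \<le> s \<and> s < m} \<union> {(m, t) | t. m < t \<and> t < hi}) \<union>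
        (median_graph lo m \<union> median_graph (Suc m) hi)"
      using False unfolding median_graph.simps[of lo hi] by (auto simp: Let_def m_def)
    have 1: "{(s, m) | s. lo \<le> s \<and> s < m} = (\<lambda>s. (s, m)) ` {lo..<m}"
      "{(m, t) | t. m < t \<and> t < hi} = (\<lambda>t. (m, t)) ` {Suc m..<hi}" by auto
    have "card (median_graph lo hi) \<le> (card {(s, m) | s. lo \<le> s \<and> s < m} + card {(m, t) | t. m < t \<and> t < hi}) +
       (card (median_graph lo m) + card (median_graph (Suc m) hi))"
      unfolding eq by (intro order_trans[OF card_Un_le] add_mono card_Un_le)
    also have "\<dots> \<le> ((m - lo) + (hi - Suc m)) + (q * (m - lo - 1) + q * (hi - Suc m - 1))"
      unfolding 1 by (intro add_mono IH) (auto intro: order_trans[OF card_image_le])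
    also have "\<dots> \<le> (hi - lo - 1) + q * (hi - lo - 1)"
    proof (rule add_mono)
      have "(m - lo - 1) + (hi - Suc m - 1) \<le> hi - lo - 1" using m by simp
      then show "q * (m - lo - 1) + q * (hi - Suc m - 1) \<le> q * (hi - lo - 1)"
        unfolding add_mult_distrib2[symmetric] by (rule mult_le_mono2)
    qed (use m in simp)
    finally show ?thesis by (simp add: r)
  qed
qed

section \<open>\<open>G\<close> and \<open>H\<close> as random sets of independent edges\<close>

lemma random_edges_one: "finite A \<Longrightarrow> (\<And>e. e \<in> A \<Longrightarrow> w e = 1) \<Longrightarrow> random_edges A w = return_pmf A"
proof (induction A rule: finite_induct)
  case (insert e A)
  have "bernoulli_pmf 1 = return_pmf True"
    by (rule pmf_eqI) (auto simp: pmf_return indicator_def elim: bool.exhaust)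
  then show ?case using insert by (simp add: random_edges_insert bind_return_pmf)
qed simp

text \<open>Disjointness is essential: a candidate shared by two of the sets would receive two
  coins.\<close>

lemma random_edges_UNION:
  assumes "finite A" "\<And>x. x \<in> A \<Longrightarrow> finite (K x)" "disjoint_family_on K A"
  shows "map_pmf (\<lambda>R. \<Union>x\<in>A. R x) (Pi_pmf A {} (\<lambda>x. random_edges (K x) w)) = random_edges (\<Union>x\<in>A. K x) w"
  using assms
proof (induction A rule: finite_induct)
  case empty
  then show ?case by simp
next
  case (insert x A)
  have disj: "K x \<inter> (\<Union>x\<in>A. K x) = {}"
    using insert.prems(2) insert.hyps(2) by (fastforce simp: disjoint_family_on_def)
  have IH: "map_pmf (\<lambda>R. \<Union>x\<in>A. R x) (Pi_pmf A {} (\<lambda>x. random_edges (K x) w)) = random_edges (\<Union>x\<in>A. K x) w"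
    using insert by (auto simp: disjoint_family_on_def)
  have upd: "(\<Union>y\<in>insert x A. (f(x := H)) y) = H \<union> (\<Union>y\<in>A. f y)" for f :: "'a \<Rightarrow> 'b set" and H
    using insert.hyps by auto
  have "map_pmf (\<lambda>R. \<Union>y\<in>insert x A. R y) (Pi_pmf (insert x A) {} (\<lambda>x. random_edges (K x) w)) =
    bind_pmf (random_edges (K x) w) (\<lambda>H. map_pmf (\<lambda>H'. H \<union> H')
      (map_pmf (\<lambda>R. \<Union>y\<in>A. R y) (Pi_pmf A {} (\<lambda>x. random_edges (K x) w))))"
    unfolding Pi_pmf_insert[OF insert.hyps] pmf.map_comp o_def case_prod_unfold pair_pmf_def map_bind_pmf
      map_return_pmf fst_conv snd_conv upd
    by (simp only: map_pmf_def)
  also have "\<dots> = random_edges (K x \<union> (\<Union>x\<in>A. K x)) w"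
    unfolding IH using insert disj by (intro random_edges_union[symmetric]) auto
  finally show ?case by simp
qed

text \<open>A pair can be both a near edge and a connector candidate. Its connector coin does not
  change the union, so the pair gets probability 1 and only \<open>B - A\<close> keeps
  \<open>p\<close>.\<close>

lemma random_edges_Un_certain:
  assumes "finite A" "finite B"
  shows "map_pmf (\<lambda>H. A \<union> H) (random_edges B (\<lambda>_. p)) = random_edges (A \<union> B) (\<lambda>e. if e \<in> A then 1 else p)"
proof -
  let ?w = "\<lambda>e. if e \<in> A then 1 else p"
  have "random_edges ((B \<inter> A) \<union> (B - A)) (\<lambda>_. p) = bind_pmf (random_edges (B \<inter> A) (\<lambda>_. p))
     (\<lambda>H. map_pmf (\<lambda>H'. H \<union> H') (random_edges (B - A) (\<lambda>_. p)))"
    by (rule random_edges_union) (use assms in auto)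
  then have "map_pmf (\<lambda>H. A \<union> H) (random_edges B (\<lambda>_. p)) = bind_pmf (random_edges (B \<inter> A) (\<lambda>_. p))
     (\<lambda>H. map_pmf (\<lambda>H'. A \<union> (H \<union> H')) (random_edges (B - A) (\<lambda>_. p)))"
    by (simp add: Int_Diff_Un map_bind_pmf pmf.map_comp o_def)
  also have "\<dots> = bind_pmf (random_edges (B \<inter> A) (\<lambda>_. p))
     (\<lambda>H. map_pmf (\<lambda>H'. A \<union> H') (random_edges (B - A) (\<lambda>_. p)))"
  proof (rule bind_pmf_cong[OF refl])
    fix H assume "H \<in> set_pmf (random_edges (B \<inter> A) (\<lambda>_. p))"
    then have "H \<subseteq> A" using set_random_edges by blast
    then have "A \<union> (H \<union> H') = A \<union> H'" for H' by auto
    then show "map_pmf (\<lambda>H'. A \<union> (H \<union> H')) (random_edges (B - A) (\<lambda>_. p)) =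
      map_pmf (\<lambda>H'. A \<union> H') (random_edges (B - A) (\<lambda>_. p))" by simp
  qed
  also have "\<dots> = map_pmf (\<lambda>H'. A \<union> H') (random_edges (B - A) (\<lambda>_. p))" by simp
  also have "random_edges (B - A) (\<lambda>_. p) = random_edges (B - A) ?w"
    by (rule random_edges_cong) simp
  also have "map_pmf (\<lambda>H'. A \<union> H') (random_edges (B - A) ?w) = random_edges (A \<union> (B - A)) ?w"
    using assms by (subst random_edges_union) (simp_all add: random_edges_one bind_return_pmf)
  finally show ?thesis by simp
qed

lemma block_disjoint: "s \<noteq> t \<Longrightarrow> 1 \<le> s \<Longrightarrow> 1 \<le> t \<Longrightarrow> block n b s \<inter> block n b t = {}"
proof (induction s t rule: linorder_wlog)
  case (le s t)
  then have *: "s * b \<le> (t - 1) * b" by (intro mult_le_mono1) simp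
  have "x \<notin> block n b t" if "x \<in> block n b s" for x
    using that * unfolding block_def atLeastAtMost_iff by linarith
  then show ?case by blast
qed (auto simp: Int_commute)

text \<open>All candidates for connector edges, before sampling; near edges may be among
  them.\<close>

definition connector_edges :: "nat \<Rightarrow> nat \<Rightarrow> nat set set" where
  "connector_edges n b = (\<Union>(s, t)\<in>block_graph n b. complete_bipartite (block n b s) (block n b t))"

lemma finite_block: "finite (block n b s)" by (simp add: block_def)

lemma finite_near_edges: "finite (near_edges n L)"
  by (rule finite_subset[of _ "Pow {..n}"]) (auto simp: near_edges_def)

lemma finite_connector_edges: "finite (connector_edges n b)"
  unfolding connector_edges_def
  by (auto simp: block_graph_def finite_median_graph intro!: finite_complete_bipartite finite_block)

text \<open>An edge determines the blocks of its two ends, and a coincidence with exchanged ends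
  would give \<open>s < t = s' < t' = s\<close>.\<close>

lemma disjoint_connectors:
  "disjoint_family_on (\<lambda>(s, t). complete_bipartite (block n b s) (block n b t)) (block_graph n b)"
  unfolding disjoint_family_on_def
proof (intro ballI impI)
  fix x y :: "nat \<times> nat" assume xy: "x \<in> block_graph n b" "y \<in> block_graph n b" "x \<noteq> y"
  obtain s t s' t' where eq: "x = (s, t)" "y = (s', t')" by (cases x; cases y)
  with xy have st: "(s, t) \<in> block_graph n b" "(s', t') \<in> block_graph n b" "s = s' \<longrightarrow> t \<noteq> t'" by auto
  then have less: "1 \<le> s" "s < t" "1 \<le> s'" "s' < t'"
    by (auto simp: block_graph_def dest: median_graph_less)
  have eqD: "x = y" if "u \<in> block n b x" "u \<in> block n b y" "1 \<le> x" "1 \<le> y" for u x y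
    using block_disjoint[of x y n b] that by blast
  have "complete_bipartite (block n b s) (block n b t) \<inter> complete_bipartite (block n b s') (block n b t') = {}"
  proof (rule ccontr)
    assume "\<not> ?thesis"
    then obtain u v u' v' where uv: "u \<in> block n b s" "v \<in> block n b t" "u' \<in> block n b s'" "v' \<in> block n b t'"
      "{u, v} = {u', v'}" unfolding complete_bipartite_def by blast
    from uv(5) have "u = u' \<and> v = v' \<or> u = v' \<and> v = u'" by (auto simp: doubleton_eq_iff)
    then show False
    proof
      assume "u = u' \<and> v = v'"
      then have "s = s'" "t = t'" using uv less eqD[of u s s'] eqD[of v t t'] by auto
      then show False using st by simp
    next
      assume "u = v' \<and> v = u'"
      then have "s = t'" "t = s'" using uv less eqD[of u s t'] eqD[of v t s'] by auto
      then show False using less by simp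
    qed
  qed
  then show "(\<lambda>(s, t). complete_bipartite (block n b s) (block n b t)) x \<inter>
    (\<lambda>(s, t). complete_bipartite (block n b s) (block n b t)) y = {}"
    by (simp add: eq)
qed

lemma random_G_eq:
  fixes n k \<psi> c \<beta> \<gamma>
  defines "b \<equiv> block_size n k \<psi> c \<beta>"
  defines "p \<equiv> connector_prob k \<psi> \<gamma> b"
  shows "random_G n k \<psi> c \<beta> \<gamma> =
    random_edges (near_edges n (clique_range k b) \<union> connector_edges n b)
      (\<lambda>e. if e \<in> near_edges n (clique_range k b) then 1 else p)"
proof -
  let ?K = "\<lambda>(s, t). complete_bipartite (block n b s) (block n b t)"
  have "map_pmf (\<lambda>R. \<Union>e\<in>block_graph n b. R e) (random_connectors n b p) = random_edges (\<Union>e\<in>block_graph n b. ?K e) (\<lambda>_. p)"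
    unfolding random_connectors_def random_subgraph_eq_random_edges case_prod_unfold
    by (rule random_edges_UNION)
      (use disjoint_connectors[of n b] in \<open>auto simp: block_graph_def finite_median_graph case_prod_unfold intro!: finite_complete_bipartite finite_block\<close>)
  then have "map_pmf (\<lambda>R. \<Union>e\<in>block_graph n b. R e) (random_connectors n b p) = random_edges (connector_edges n b) (\<lambda>_. p)"
    by (simp add: connector_edges_def)
  from this[symmetric] have "random_G n k \<psi> c \<beta> \<gamma> =
    map_pmf (\<lambda>H. near_edges n (clique_range k b) \<union> H) (random_edges (connector_edges n b) (\<lambda>_. p))"
    by (simp add: random_G_def Let_def b_def[symmetric] p_def[symmetric] pmf.map_comp o_def)
  then show ?thesis
    by (simp add: random_edges_Un_certain finite_near_edges finite_connector_edges)
qed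

lemma random_H_eq:
  fixes n k \<psi> c \<beta> \<gamma>
  defines "b \<equiv> block_size n k \<psi> c \<beta>"
  defines "p \<equiv> connector_prob k \<psi> \<gamma> b"
  assumes "0 \<le> p" "p \<le> 1" "0 \<le> \<psi>" "\<psi> \<le> 1"
  shows "random_H n k \<psi> c \<beta> \<gamma> =
    random_edges (near_edges n (clique_range k b) \<union> connector_edges n b)
      (\<lambda>e. (if e \<in> near_edges n (clique_range k b) then 1 else p) * \<psi>)"
  unfolding random_H_def random_subgraph_eq_random_edges random_G_eq b_def[symmetric] p_def[symmetric]
  by (rule random_edges_thin) (use assms in \<open>auto simp: finite_near_edges finite_connector_edges\<close>)

text \<open>The least such \<open>r\<close> satisfies \<open>2 ^ (r - 1) \<le> n\<close>, so
  \<open>r * ln 2 \<le> 2 * ln n\<close>, and \<open>ln 2 \<ge> 2 / 3\<close>. This bounds the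
  recursion depth of the block graph.\<close>

lemma two_power_log_bound:
  assumes "2 \<le> n"
  obtains r where "n < 2 ^ r" "real r \<le> 3 * ln (real n)"
proof -
  define r where "r = (LEAST r. n < 2 ^ r)"
  have r: "n < 2 ^ r" unfolding r_def by (rule LeastI[of _ n]) (rule less_exp)
  then obtain q where q: "r = Suc q" using assms by (cases r) auto
  then have "2 ^ q \<le> n" using not_less_Least[of q "\<lambda>r. n < 2 ^ r"] by (simp add: r_def)
  then have "real (2 ^ q) \<le> real n" by (simp only: of_nat_le_iff)
  then have "ln (2 ^ q) \<le> ln (real n)" using assms by (subst ln_le_cancel_iff) auto
  then have "real q * ln 2 \<le> ln (real n)" by (simp add: ln_realpow)
  moreover have "ln 2 \<le> ln (real n)" using assms by simp
  ultimately have "real r * ln 2 \<le> 2 * ln (real n)" by (simp add: q algebra_simps)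
  moreover have "real r * (2 / 3) \<le> real r * ln 2" using ln2_ge_two_thirds by (intro mult_left_mono) auto
  ultimately show thesis using r that[of r] by linarith
qed

text \<open>The least \<open>M\<close> at which the threshold 1 is reached is bounded in two ways.
  From \<open>D ^ 2 * D ^ (k - 3) = D ^ (k - 1)\<close> follows \<open>M \<le> k - 3\<close>, so
  \<open>M + 3\<close> hops are allowed; from minimality follows
  \<open>2 ^ M \<le> 2 / \<psi>\<close>, a bound free of \<open>k\<close>.\<close>

lemma exists_layer_number:
  fixes \<psi> D s :: real
  assumes "0 < \<psi>" "\<psi> < 1" "1 \<le> D" "1 \<le> s" "3 < k" "1 \<le> \<psi> * D ^ (k - 1)"
  obtains M where "M \<le> k - 3" "\<And>r. r < M \<Longrightarrow> \<psi> * D\<^sup>2 * s * (2 * D) ^ r \<le> 1"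
    "1 \<le> \<psi> * D\<^sup>2 * s * (2 * D) ^ M" "2 ^ M \<le> 2 / \<psi>"
proof -
  define P where "P M \<longleftrightarrow> 1 \<le> \<psi> * D\<^sup>2 * s * (2 * D) ^ M" for M :: nat
  have Pk: "P (k - 3)"
  proof -
    have "1 * 1 \<le> (s * 2 ^ (k - 3)) * (\<psi> * D ^ (k - 1))"
      using assms by (intro mult_mono) (auto intro: mult_ge1_I)
    also have "k - 1 = 2 + (k - 3)" using assms(5) by simp
    finally show ?thesis by (simp add: P_def power_mult_distrib power_add power2_eq_square mult_ac)
  qed
  define M where "M = (LEAST M. P M)"
  have M: "P M" "M \<le> k - 3" unfolding M_def using Pk by (auto intro: LeastI Least_le)
  have less: "\<not> P r" if "r < M" for r using not_less_Least that by (auto simp: M_def)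
  have "2 ^ M \<le> 2 / \<psi>"
  proof (cases M)
    case 0
    then show ?thesis using assms by (simp add: divide_simps)
  next
    case (Suc q)
    then have "\<psi> * D\<^sup>2 * s * (2 * D) ^ q \<le> 1" using less[of q] by (simp add: P_def)
    moreover have "\<psi> * 1 * 1 * 2 ^ q \<le> \<psi> * D\<^sup>2 * s * (2 * D) ^ q"
      using assms by (intro mult_mono power_mono mult_left_mono) auto
    ultimately have "\<psi> * 2 ^ q \<le> 1" by simp
    then show ?thesis using assms Suc by (simp add: divide_simps mult_ac)
  qed
  moreover have "\<psi> * D\<^sup>2 * s * (2 * D) ^ r \<le> 1" if "r < M" for r
    using less[OF that] unfolding P_def by linarith
  ultimately show thesis using M that[of M] by (simp only: P_def)
qed

section \<open>Parameters of the construction\<close>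

locale spanner_params =
  fixes n k :: nat and \<psi> c \<beta> \<gamma> :: real
  assumes \<beta>: "0 < \<beta>" and \<gamma>: "0 < \<gamma>" and \<psi>: "0 < \<psi>" "\<psi> < 1" and n: "2 \<le> n" and k: "3 < k"
    and c: "1 \<le> \<beta> * c * ln 2" "\<gamma> \<le> \<beta> * c * ln 2"
begin

abbreviation "D \<equiv> nabla k \<psi>"

text \<open>The scale \<open>\<psi> powr (- 1 - 1 / (real k - 1))\<close> of all the bounds.\<close>

definition "\<Delta> = D / \<psi>"

definition "b = block_size n k \<psi> c \<beta>"
definition "L = clique_range k b"
definition "p = connector_prob k \<psi> \<gamma> b"
definition "E = near_edges n L \<union> connector_edges n b"
definition "wG e = (if e \<in> near_edges n L then 1 else p)"
definition "w e = wG e * \<psi>"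

lemma D_powr: "D = \<psi> powr (- (1 / (real k - 1)))"
  by (simp add: nabla_def powr_minus_divide)

lemma D_ge_1: "1 \<le> D"
proof -
  have "\<psi> powr (1 / (real k - 1)) \<le> 1"
    using powr_mono2[of "1 / (real k - 1)" \<psi> 1] \<psi> k by simp
  then show ?thesis using \<psi> by (simp add: nabla_def divide_simps)
qed

text \<open>The reason for the exponent \<open>1 / (k - 1)\<close> in \<open>nabla\<close>: on a
  path of \<open>k\<close> hops, \<open>k - 1\<close> gains of \<open>D\<close> exactly compensate
  one factor \<open>\<psi>\<close>.\<close>

lemma D_power: "\<psi> * D ^ (k - 1) = 1"
proof -
  have "D ^ (k - 1) = \<psi> powr (- (1 / (real k - 1)) * real (k - 1))"
    unfolding D_powr using \<psi> by (subst powr_power) auto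
  also have "- (1 / (real k - 1)) * real (k - 1) = - 1" using k by (simp add: of_nat_diff)
  finally show ?thesis using \<psi> by (simp add: powr_minus_divide)
qed

lemma divide_psi_powr: "x / \<psi> powr (1 + 1 / (real k - 1)) = x * \<Delta>"
  using \<psi> by (simp add: \<Delta>_def nabla_def powr_add)

lemma psi_powr: "\<psi> powr (- 1 - 1 / (real k - 1)) = \<Delta>"
  using \<psi> powr_add[of \<psi> "-1" "- (1 / (real k - 1))"] by (simp add: \<Delta>_def D_powr powr_minus_divide)

lemma D_psi: "1 \<le> \<Delta>" "1 / \<psi> \<le> \<Delta>" "0 < \<Delta>"
proof -
  show "1 \<le> \<Delta>" "1 / \<psi> \<le> \<Delta>"
    using D_ge_1 \<psi> by (simp_all add: \<Delta>_def divide_simps)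
  then show "0 < \<Delta>" by linarith
qed

lemma ln_n: "ln 2 \<le> ln (real n)" "2 / 3 \<le> ln (real n)" "0 < ln (real n)"
proof -
  show "ln 2 \<le> ln (real n)" using n by simp
  then show "2 / 3 \<le> ln (real n)" using ln2_ge_two_thirds by linarith
  then show "0 < ln (real n)" by linarith
qed

lemma c_pos: "0 < \<beta> * c"
proof -
  have "0 < \<beta> * c * ln 2" using c by linarith
  then show ?thesis by (simp add: zero_less_mult_iff)
qed

text \<open>How large \<open>c\<close> must be. The first inequality makes the number rounded up to
  \<open>b\<close> at least 1, so rounding costs at most a factor 2; the second gives
  \<open>\<gamma> * \<Delta> \<le> b\<close>, so that \<open>\<gamma> * \<Delta> / b\<close> is a
  probability.\<close>

lemma c_ln_n: "1 \<le> \<beta> * c * ln (real n)" "\<gamma> \<le> \<beta> * c * ln (real n)"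
proof -
  have "\<beta> * c * ln 2 \<le> \<beta> * c * ln (real n)" using c_pos ln_n by (intro mult_left_mono) auto
  then show "1 \<le> \<beta> * c * ln (real n)" "\<gamma> \<le> \<beta> * c * ln (real n)" using c by linarith+
qed

lemma b_bounds: "\<beta> * c * \<Delta> * ln (real n) \<le> real b" "real b \<le> 2 * (\<beta> * c * \<Delta> * ln (real n))" "1 \<le> b"
proof -
  let ?x = "\<beta> * c * \<Delta> * ln (real n)"
  have "1 * 1 \<le> (\<beta> * c * ln (real n)) * \<Delta>"
    using c_ln_n D_psi by (intro mult_mono) auto
  then have x: "1 \<le> ?x" by (simp add: mult_ac)
  have "b = max 1 (nat \<lceil>?x\<rceil>)" by (simp add: b_def block_size_def \<Delta>_def mult_ac)
  also have "\<dots> = nat \<lceil>?x\<rceil>" using x by (simp add: max_def) linarith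
  finally have b: "b = nat \<lceil>?x\<rceil>" .
  then show "?x \<le> real b" by linarith
  show "real b \<le> 2 * ?x" "1 \<le> b" using b x by linarith+
qed

lemma p_eq: "p = \<gamma> * \<Delta> / real b" and p_bounds: "0 \<le> p" "p \<le> 1"
proof -
  have "\<gamma> * \<Delta> \<le> (\<beta> * c * ln (real n)) * \<Delta>"
    using c_ln_n D_psi by (intro mult_right_mono) auto
  also have "\<dots> \<le> real b" using b_bounds by (simp add: mult_ac)
  finally have "\<gamma> * \<Delta> / real b \<le> 1" using b_bounds by (simp add: pos_divide_le_eq)
  moreover have "0 \<le> \<gamma> * \<Delta> / real b" using \<gamma> D_psi by (intro divide_nonneg_nonneg mult_nonneg_nonneg) auto
  ultimately show "p = \<gamma> * \<Delta> / real b" "0 \<le> p" "p \<le> 1"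
    by (simp_all add: p_def connector_prob_def flip: \<Delta>_def)
qed

lemma random_G: "random_G n k \<psi> c \<beta> \<gamma> = random_edges E wG"
  unfolding random_G_eq E_def wG_def[abs_def] L_def b_def p_def ..

lemma random_H: "random_H n k \<psi> c \<beta> \<gamma> = random_edges E w"
  unfolding E_def w_def[abs_def] wG_def[abs_def] L_def p_def b_def
  by (rule random_H_eq) (use p_bounds \<psi> in \<open>simp_all add: p_def b_def\<close>)

lemma finite_E: "finite E"
  by (simp add: E_def finite_near_edges finite_connector_edges)

lemma wG_bounds: "0 \<le> wG e \<and> wG e \<le> 1"
  using p_bounds by (simp add: wG_def)

lemma w_bounds: "0 \<le> w e \<and> w e \<le> 1"
  using wG_bounds[of e] \<psi> by (simp add: w_def mult_le_one)

lemma near_edge: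
  assumes "1 \<le> u" "u < v" "v \<le> n" "v - u \<le> L"
  shows "{u, v} \<in> E \<and> \<psi> \<le> w {u, v}"
proof -
  have "{u, v} \<in> near_edges n L" using assms by (auto simp: near_edges_def)
  then show ?thesis by (simp add: E_def w_def wG_def)
qed

lemma connector_edge:
  assumes "(s, t) \<in> block_graph n b" "u \<in> block n b s" "v \<in> block n b t"
  shows "{u, v} \<in> E \<and> p * \<psi> \<le> w {u, v}"
proof -
  have "{u, v} \<in> connector_edges n b"
    using assms by (auto simp: connector_edges_def complete_bipartite_def)
  moreover have "p * \<psi> \<le> w {u, v}" using p_bounds \<psi> by (auto simp: w_def wG_def)
  ultimately show ?thesis by (simp add: E_def)
qed

section \<open>Failure probability for a single pair\<close>

abbreviation "no_path i j \<equiv> measure_pmf.prob (random_edges E w) {H. \<not> has_straight_path H k i j}"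

text \<open>Rounding up at most doubles the interval lengths \<open>8 * s * \<Delta>\<close> and
  \<open>8 * \<Delta>\<close>, whence 16. Both bounds on \<open>M\<close> are offered in the length
  condition, because one application uses the bound by \<open>k\<close> and the other the bound by
  \<open>\<psi>\<close>.\<close>

lemma near_pair:
  assumes s: "1 \<le> s" and ij: "1 \<le> i" "i < j" "j \<le> n" "j - i \<le> L"
    and len: "\<And>M. M \<le> k - 3 \<Longrightarrow> 2 ^ M \<le> 2 / \<psi> \<Longrightarrow> 16 * (2 * s + real M) * \<Delta> < real (j - i)"
  shows "no_path i j \<le> 5 * exp (- s)"
proof -
  obtain M where M: "M \<le> k - 3" "\<And>r. r < M \<Longrightarrow> \<psi> * D\<^sup>2 * s * (2 * D) ^ r \<le> 1"
    "1 \<le> \<psi> * D\<^sup>2 * s * (2 * D) ^ M" "2 ^ M \<le> 2 / \<psi>"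
    by (rule exists_layer_number[OF \<psi> D_ge_1 s k]) (use D_power in auto)
  define T1 where "T1 = nat \<lceil>8 * s * D / \<psi>\<rceil>"
  define T2 where "T2 = nat \<lceil>8 * D / \<psi>\<rceil>"
  have ceil: "x \<le> real (nat \<lceil>x\<rceil>)" "1 \<le> x \<Longrightarrow> real (nat \<lceil>x\<rceil>) \<le> 2 * x" for x :: real
    by linarith+
  have "1 * 1 \<le> s * \<Delta>" using s D_psi by (intro mult_mono) auto
  moreover have "8 * s * D / \<psi> = 8 * (s * \<Delta>)" by (simp add: \<Delta>_def)
  ultimately have T1: "8 * s * D / \<psi> \<le> real T1" "real T1 \<le> 16 * s * \<Delta>"
    using ceil[of "8 * (s * \<Delta>)"] by (simp_all add: T1_def)
  have T2: "8 * D / \<psi> \<le> real T2" "real T2 \<le> 16 * \<Delta>"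
    using ceil[of "8 * D / \<psi>"] D_psi by (auto simp: T2_def \<Delta>_def)
  have "real (2 * T1 + M * T2) \<le> 2 * (16 * s * \<Delta>) + real M * (16 * \<Delta>)"
    using mult_left_mono[OF T2(2), of "real M"] T1(2) by simp
  also have "\<dots> = 16 * (2 * s + real M) * \<Delta>" by (simp add: algebra_simps)
  also have "\<dots> < real (j - i)" by (rule len) (use M in auto)
  finally have "i + 2 * T1 + M * T2 < j" using ij by linarith
  then have "measure_pmf.prob (random_edges E w) {H. \<not> has_straight_path H (M + 3) i j} \<le> 5 * exp (- s)"
    using ij by (intro prob_no_path_near[OF finite_E w_bounds \<psi> D_ge_1 s M(2,3) T1(1) T2(1)] near_edge) auto
  moreover have "no_path i j \<le> measure_pmf.prob (random_edges E w) {H. \<not> has_straight_path H (M + 3) i j}"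
    using M(1) k by (intro prob_mono_support) (auto dest: has_straight_path_more_hops[of _ "M + 3" _ _ k])
  ultimately show ?thesis by linarith
qed

text \<open>Decay in the distance allows summation over \<open>j\<close>. With \<open>s\<close> the
  distance in units of \<open>17 * k * \<Delta>\<close>, \<open>M \<le> k - 3\<close> gives
  \<open>2 * s + M \<le> k * s\<close>, and 17 instead of 16 makes the length inequality
  strict.\<close>

lemma near_pair_exp:
  assumes ij: "1 \<le> i" "i < j" "j \<le> n" "j - i \<le> L"
  shows "no_path i j \<le> 5 * exp (- (real (j - i) / (17 * real k * \<Delta>)))"
proof -
  define Z where "Z = 17 * real k * \<Delta>"
  define s where "s = real (j - i) / Z"
  have pos: "0 < Z" using k D_psi by (simp add: Z_def)
  show ?thesis
  proof (cases "1 \<le> s")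
    case True
    have "16 * (2 * s + real M) * \<Delta> < real (j - i)" if "M \<le> k - 3" for M
    proof -
      have "2 * s + real M * 1 \<le> 2 * s + real (k - 3) * s"
        using that True by (intro add_mono mult_mono) auto
      also have "\<dots> \<le> real k * s" using k True by (simp add: of_nat_diff algebra_simps)
      finally have "16 * (2 * s + real M) * \<Delta> \<le> 16 * (real k * s) * \<Delta>"
        using D_psi by (intro mult_right_mono) auto
      also have "\<dots> < 17 * (real k * s) * \<Delta>"
        using k True D_psi by (intro mult_strict_right_mono) auto
      also have "\<dots> = s * Z" by (simp add: Z_def)
      also have "\<dots> = real (j - i)" using pos by (simp add: s_def)
      finally show ?thesis .
    qed
    then show ?thesis using near_pair[OF True ij] by (simp only: s_def Z_def)
  next
    case False
    \<comment> \<open>For \<open>s < 1\<close> the claimed bound is at least 1.\<close>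
    have "1 \<le> 5 * exp (- 1 :: real)" using exp_le by (simp add: exp_minus divide_simps)
    also have "\<dots> \<le> 5 * exp (- s)" using False by simp
    finally show ?thesis using measure_pmf.prob_le_1[of "random_edges E w"] by (metis order_trans s_def Z_def)
  qed
qed

lemma near_pair_whp:
  assumes ij: "1 \<le> i" "j \<le> n" "j - i \<le> L" and d: "0 \<le> d"
    and far: "16 * (2 * d + 9) * (\<Delta> * ln (real n)) < real j - real i"
  shows "no_path i j \<le> 1 / real n powr d"
proof -
  \<comment> \<open>The 3 absorbs the constant 5 through \<open>5 / n ^ 3 \<le> 1\<close>; with
    \<open>M \<le> 3 * ln n\<close> it leads to \<open>2 * (d + 3) + 3 = 2 * d + 9\<close> in the
    distance.\<close>
  define s where "s = (d + 3) * ln (real n)"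
  have "0 \<le> \<Delta> * ln (real n)" using D_psi ln_n by simp
  then have "0 \<le> 16 * (2 * d + 9) * (\<Delta> * ln (real n))" using d by simp
  then have ij': "i < j" "real (j - i) = real j - real i" using far by auto
  have "3 * (2 / 3) \<le> s" unfolding s_def using d ln_n by (intro mult_mono) auto
  then have s: "1 \<le> s" by simp
  have "9 * (2 / 3) \<le> 16 * (2 * d + 9) * ln (real n)" using d ln_n by (intro mult_mono) auto
  then have "1 * (1 / \<psi>) \<le> 16 * (2 * d + 9) * ln (real n) * \<Delta>"
    using d ln_n D_psi \<psi> by (intro mult_mono) auto
  \<comment> \<open>Two vertices of \<open>[n]\<close> can be this far apart only if
    \<open>1 / \<psi> \<le> n\<close>; this turns \<open>2 ^ M \<le> 2 / \<psi>\<close> into a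
    logarithmic bound on \<open>M\<close>.\<close>
  then have psi_n: "1 / \<psi> \<le> real n" using far ij by (simp add: mult_ac)
  have "no_path i j \<le> 5 * exp (- s)"
  proof (rule near_pair[OF s ij(1) ij'(1) ij(2,3)])
    fix M assume "2 ^ M \<le> 2 / \<psi>"
    then have "2 ^ M \<le> 2 * real n" using psi_n by simp
    then have "ln (2 ^ M) \<le> ln (2 * real n)" using n by (subst ln_le_cancel_iff) auto
    then have "real M * ln 2 \<le> 2 * ln (real n)" using n ln_n(1) by (simp add: ln_realpow ln_mult del: ln_le_cancel_iff)
    moreover have "real M * (2 / 3) \<le> real M * ln 2" using ln2_ge_two_thirds by (intro mult_left_mono) auto
    ultimately have "real M \<le> 3 * ln (real n)" by linarith
    then have "16 * (2 * s + real M) * \<Delta> \<le> 16 * (2 * s + 3 * ln (real n)) * \<Delta>"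
      using D_psi by (intro mult_right_mono) auto
    also have "\<dots> = 16 * (2 * d + 9) * (\<Delta> * ln (real n))" by (simp add: s_def algebra_simps add_divide_distrib)
    finally show "16 * (2 * s + real M) * \<Delta> < real (j - i)" using far ij' by linarith
  qed
  also have "\<dots> = 5 * (1 / real n powr (d + 3))" using n by (simp add: s_def powr_def exp_minus divide_simps)
  also have "\<dots> = 5 / real n ^ 3 * (1 / real n powr d)" using n by (simp add: powr_add powr_realpow)
  also have "\<dots> \<le> 1 * (1 / real n powr d)"
  proof (intro mult_right_mono)
    have "(2::real) ^ 3 \<le> real n ^ 3" using n by (intro power_mono) auto
    then show "5 / real n ^ 3 \<le> 1" using n by (simp add: divide_simps)
  qed simp
  finally show ?thesis by simp
qed

lemma far_pair:
  assumes ij: "1 \<le> i" "j \<le> n" "i + L < j" and d: "0 \<le> d"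
    and cd: "d + 2 \<le> (min 1 (\<gamma> / 4))\<^sup>2 * (\<beta> * c / 4)"
  shows "no_path i j \<le> 1 / real n powr d"
proof -
  define \<kappa> where "\<kappa> = min 1 (\<gamma> / 4)"
  \<comment> \<open>Chosen so that \<open>4 * l * \<Delta>\<close> is the lower bound for
    \<open>b\<close>.\<close>
  define l where "l = \<beta> * c * ln (real n) / 4"
  define s where "s = (i - 1) div b"
  \<comment> \<open>The index, counted from 0, of the block before that of \<open>j\<close>: this
    block and all earlier ones have exactly \<open>b\<close> vertices. \<open>R\<close> shifts to
    the indices of \<open>block_graph\<close>, which start at 1.\<close>
  define \<tau> where "\<tau> = (j - 1) div b - 1"
  define R where "R x y \<longleftrightarrow> (Suc x, Suc y) \<in> block_graph n b \<and> y \<le> \<tau>" for x y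
  have b: "0 < b" using b_bounds by simp
  \<comment> \<open>The distance \<open>L = (k + 4) * b\<close> places block
    \<open>s + k - 2\<close> before block \<open>\<tau>\<close>.\<close>
  have "(i - 1 + (k + 4) * b) div b \<le> (j - 1) div b"
    using ij by (intro div_le_mono) (auto simp: L_def clique_range_def)
  then have s_\<tau>: "s + k + 4 \<le> Suc \<tau>" using b by (simp add: s_def \<tau>_def)
  then have \<tau>: "Suc \<tau> = (j - 1) div b" using k by (simp add: \<tau>_def)
  have mod_i: "s * b + (i - 1) mod b = i - 1" "(i - 1) mod b < b" using b by (simp_all add: s_def)
  have mod_j: "Suc \<tau> * b + (j - 1) mod b = j - 1" "(j - 1) mod b < b" unfolding \<tau> using b by simp_all
  have j: "\<tau> * b + b < j" "j \<le> \<tau> * b + 2 * b" using mod_j ij by auto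
  have block: "block n b (Suc x) = {x * b + 1..<x * b + 1 + b}" if "x \<le> \<tau>" for x
  proof -
    have "Suc x * b \<le> Suc \<tau> * b" using that by (intro mult_le_mono1) simp
    moreover have "Suc \<tau> * b \<le> n" using j ij unfolding mult_Suc by linarith
    ultimately have "Suc x * b \<le> n" by (rule order_trans)
    then show ?thesis by (auto simp: block_def min_def)
  qed
  have blocks: "Suc \<tau> < num_blocks n b + 1"
  proof -
    have "real (Suc \<tau> * b) \<le> real n" using j ij unfolding mult_Suc of_nat_le_iff by linarith
    then have "real (Suc \<tau>) \<le> real n / real b" using b by (simp only: of_nat_mult pos_le_divide_eq of_nat_0_less_iff)
    then show ?thesis unfolding num_blocks_def by linarith
  qed
  have l: "d + 2 \<le> l * \<kappa>\<^sup>2 / ln (real n)" using cd ln_n by (simp add: l_def \<kappa>_def mult_ac)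
  then have l': "(d + 2) * ln (real n) \<le> l * \<kappa>\<^sup>2" using ln_n by (simp add: pos_le_divide_eq)
  have "2 * (2 / 3) \<le> (d + 2) * ln (real n)" using d ln_n by (intro mult_mono) auto
  then have l1: "1 \<le> l * \<kappa>\<^sup>2" using l' by linarith
  have "no_path i j \<le> real k * exp (- (l * (min 1 (\<gamma> / 4))\<^sup>2))"
  proof (rule prob_no_path_far[OF finite_E w_bounds \<psi> D_ge_1 \<gamma> _ _ _ _ _ _ k _ _ j])
    show "0 \<le> l" using c_pos ln_n by (simp add: l_def)
    show "4 * l * D / \<psi> \<le> real b" using b_bounds(1) by (simp add: l_def \<Delta>_def mult_ac)
    show "1 \<le> l * (min 1 (\<gamma> / 4))\<^sup>2" using l1 by (simp add: \<kappa>_def)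
    show "0 \<le> p * \<psi>" "p * \<psi> \<le> 1" using p_bounds \<psi> by (simp_all add: mult_le_one)
    show "real b * (p * \<psi>) = \<gamma> * D" using \<psi> b by (simp add: p_eq \<Delta>_def)
    show "1 \<le> \<psi> * D ^ (k - 1)" using D_power by simp
    show "i \<in> {s * b + 1..<s * b + 1 + b}" using mod_i ij by auto
    show "s + k - 2 < \<tau>" using s_\<tau> k by simp
    show "{u, v} \<in> E \<and> \<psi> \<le> w {u, v}" if "i \<le> u" "u < v" "v \<le> j" "v - u \<le> 3 * b" for u v
    proof (rule near_edge)
      have "3 * b \<le> L" by (simp add: L_def clique_range_def)
      then show "v - u \<le> L" using that by simp
    qed (use that ij in auto)
    show "{u, v} \<in> E \<and> p * \<psi> \<le> w {u, v}"
      if "R x y" "u \<in> {x * b + 1..<x * b + 1 + b}" "v \<in> {y * b + 1..<y * b + 1 + b}" for x y u v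
    proof (rule connector_edge)
      show "(Suc x, Suc y) \<in> block_graph n b" using that by (simp add: R_def)
      then have "x < y" by (auto simp: block_graph_def dest: median_graph_less)
      then show "u \<in> block n b (Suc x)" "v \<in> block n b (Suc y)" using that block[of x] block[of y] by (simp_all add: R_def)
    qed
    show "R (s + k - 2) \<tau> \<or> (\<exists>m>s + k - 2. m < \<tau> \<and> R (s + k - 2) m \<and> R m \<tau>)"
    proof -
      have "(Suc (s + k - 2), Suc \<tau>) \<in> block_graph n b \<or>
        (\<exists>m. Suc (s + k - 2) < m \<and> m < Suc \<tau> \<and> (Suc (s + k - 2), m) \<in> block_graph n b \<and> (m, Suc \<tau>) \<in> block_graph n b)"
        unfolding block_graph_def by (rule median_graph_two_hops) (use s_\<tau> k blocks in auto)
      then show ?thesis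
      proof (elim disjE exE conjE)
        fix m assume m: "Suc (s + k - 2) < m" "m < Suc \<tau>" "(Suc (s + k - 2), m) \<in> block_graph n b" "(m, Suc \<tau>) \<in> block_graph n b"
        then obtain m' where "m = Suc m'" by (cases m) auto
        then show ?thesis using m by (intro disjI2 exI[of _ m']) (auto simp: R_def)
      qed (simp add: R_def)
    qed
  qed
  \<comment> \<open>Since \<open>k \<le> L < j \<le> n\<close>, the factor \<open>k\<close> costs
    only one power of \<open>n\<close>.\<close>
  also have "\<dots> \<le> real n * exp (- ((d + 2) * ln (real n)))"
  proof (rule mult_mono)
    have "k * 1 \<le> L" unfolding L_def clique_range_def using b by (intro mult_le_mono) auto
    then show "real k \<le> real n" using ij by simp
  qed (use l' in \<open>auto simp: \<kappa>_def\<close>)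
  also have "\<dots> = 1 / real n powr (d + 1)"
  proof -
    have "real n = exp (ln (real n))" using n by simp
    then have "real n * exp (- ((d + 2) * ln (real n))) = exp (ln (real n) + - ((d + 2) * ln (real n)))"
      by (simp only: exp_add)
    also have "\<dots> = exp (- ((d + 1) * ln (real n)))" by (simp add: algebra_simps)
    finally show ?thesis using n by (simp add: powr_def exp_minus divide_simps)
  qed
  also have "\<dots> \<le> 1 / real n powr d" using n by (intro divide_left_mono powr_mono) auto
  finally show ?thesis .
qed

end

section \<open>Counting edges and summing tails\<close>

lemma prob_Collect_not: "measure_pmf.prob M {x. \<not> P x} = 1 - measure_pmf.prob M {x. P x}"
  using measure_pmf.prob_compl[of "{x. P x}" M] by (simp add: Collect_neg_eq Compl_eq_Diff_UNIV)

lemma card_near_edges_le: "card (near_edges n L) \<le> n * L"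
proof -
  have "near_edges n L \<subseteq> (\<lambda>(u, x). {u, u + x}) ` ({1..n} \<times> {1..L})"
  proof
    fix e assume "e \<in> near_edges n L"
    then obtain u v where "e = {u, v}" "1 \<le> u" "u < v" "v \<le> n" "v - u \<le> L" by (auto simp: near_edges_def)
    then show "e \<in> (\<lambda>(u, x). {u, u + x}) ` ({1..n} \<times> {1..L})"
      by (intro image_eqI[of _ _ "(u, v - u)"]) auto
  qed
  then have "card (near_edges n L) \<le> card ({1..n} \<times> {1..L})"
    by (rule surj_card_le[rotated]) simp
  then show ?thesis by simp
qed

lemma card_block_le: "card (block n b s) \<le> b"
proof (cases s)
  case (Suc q)
  have "block n b s \<subseteq> {q * b + 1..q * b + b}" by (auto simp: block_def Suc)
  from card_mono[OF _ this] show ?thesis by simp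
qed (simp add: block_def)

lemma card_complete_bipartite_le:
  assumes "finite A" "finite B"
  shows "card (complete_bipartite A B) \<le> card A * card B"
proof -
  have "complete_bipartite A B = (\<lambda>(u, v). {u, v}) ` (A \<times> B)"
    by (auto simp: complete_bipartite_def)
  then show ?thesis using card_image_le[of "A \<times> B" "\<lambda>(u, v). {u, v}"] assms by (simp add: card_cartesian_product)
qed

lemma card_connector_edges_le: "card (connector_edges n b) \<le> card (block_graph n b) * (b * b)"
proof -
  have "card (connector_edges n b) \<le> (\<Sum>(s, t)\<in>block_graph n b. card (complete_bipartite (block n b s) (block n b t)))"
    unfolding connector_edges_def case_prod_unfold
    by (rule card_UN_le) (simp add: block_graph_def finite_median_graph)
  also have "\<dots> \<le> (\<Sum>(s, t)\<in>block_graph n b. b * b)"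
  proof (rule sum_mono, clarify)
    fix s t
    have "card (complete_bipartite (block n b s) (block n b t)) \<le> card (block n b s) * card (block n b t)"
      by (rule card_complete_bipartite_le) (simp_all add: finite_block)
    also have "\<dots> \<le> b * b" by (intro mult_le_mono card_block_le)
    finally show "card (complete_bipartite (block n b s) (block n b t)) \<le> b * b" .
  qed
  finally show ?thesis by simp
qed

text \<open>Markov's inequality for \<open>2 ^ card H\<close>, whose expectation is at most
  \<open>exp (sum w E)\<close> because \<open>1 + w e \<le> exp (w e)\<close>.\<close>

lemma prob_card_random_edges_gt:
  assumes "finite E" "\<And>e. e \<in> E \<Longrightarrow> 0 \<le> w e \<and> w e \<le> 1"
  shows "measure_pmf.prob (random_edges E w) {H. t < real (card H)} \<le> exp (sum w E - t * ln 2)"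
proof -
  have "measure_pmf.prob (random_edges E w) {H. t < real (card H)} \<le>
    measure_pmf.expectation (random_edges E w) (\<lambda>H. exp (- t * ln 2) * 2 ^ card H)"
    unfolding prob_eq_expectation
  proof (rule expectation_mono_pmf)
    fix H :: "'a set"
    have "1 \<le> exp (- t * ln 2) * 2 ^ card H" if "t < real (card H)"
    proof -
      have "0 \<le> (real (card H) - t) * ln 2" using that by simp
      then have "1 \<le> exp ((real (card H) - t) * ln 2)" by simp
      also have "\<dots> = exp (- t * ln 2) * exp (real (card H) * ln 2)"
        by (simp add: algebra_simps flip: exp_add)
      finally show ?thesis by (simp add: exp_of_nat_mult)
    qed
    then show "indicat_real {H. t < real (card H)} H \<le> exp (- t * ln 2) * 2 ^ card H"
      by (simp add: indicator_def)
  qed (rule finite_set_random_edges[OF assms(1)])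
  also have "\<dots> = exp (- t * ln 2) * (\<Prod>e\<in>E. 1 + (2 - 1) * w e)"
    using expectation_random_edges_power_card[OF assms, where z = 2] by simp
  also have "\<dots> \<le> exp (- t * ln 2) * (\<Prod>e\<in>E. exp (w e))"
    using assms(2) exp_ge_add_one_self by (intro mult_left_mono prod_mono) auto
  also have "\<dots> = exp (sum w E - t * ln 2)"
    using assms(1) by (simp add: exp_sum exp_diff exp_minus divide_simps)
  finally show ?thesis .
qed

text \<open>The sum is geometric and at most \<open>q / (1 - q)\<close>;
  \<open>exp (1 / Z) \<ge> 1 + 1 / Z\<close> bounds this by \<open>Z\<close>.\<close>

lemma sum_exp_neg_le:
  assumes "0 < Z"
  shows "(\<Sum>l\<in>{1..n}. exp (- (real l / Z))) \<le> Z"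
proof -
  define q where "q = exp (- (1 / Z))"
  have q: "0 < q" "q < 1" using assms by (simp_all add: q_def)
  have "exp (- (real l / Z)) = q ^ l" for l by (simp add: q_def flip: exp_of_nat_mult)
  then have "(\<Sum>l\<in>{1..n}. exp (- (real l / Z))) = (\<Sum>l\<in>{1..n}. q ^ l)" by simp
  also have "\<dots> = q * (\<Sum>l<n. q ^ l)"
    by (simp add: sum.atLeast1_atMost_eq sum_distrib_left)
  also have "\<dots> \<le> q * (1 / (1 - q))"
  proof (intro mult_left_mono)
    have "(\<Sum>l<n. q ^ l) = (1 - q ^ n) / (1 - q)" using q by (simp add: sum_gp_strict)
    also have "\<dots> \<le> 1 / (1 - q)" using q by (intro divide_right_mono) auto
    finally show "(\<Sum>l<n. q ^ l) \<le> 1 / (1 - q)" .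
  qed (use q in simp)
  also have "\<dots> \<le> Z"
  proof -
    have "1 + 1 / Z \<le> exp (1 / Z)" by (rule exp_ge_add_one_self)
    then have "q * (1 + 1 / Z) \<le> q * exp (1 / Z)" using q by (intro mult_left_mono) auto
    also have "\<dots> = 1" by (simp add: q_def flip: exp_add)
    finally have "q * (Z + 1) \<le> Z" using assms by (simp add: field_simps)
    then show ?thesis using q by (simp add: field_simps)
  qed
  finally show ?thesis .
qed

section \<open>Number of edges, existence of paths, and bad pairs\<close>

context spanner_params
begin

text \<open>There are at most \<open>n * L\<close> near edges. The block graph has at most
  \<open>3 * ln n * n / b\<close> edges, each standing for at most \<open>b * b\<close> candidates
  of probability \<open>\<gamma> * \<Delta> / b\<close>, so \<open>b\<close> cancels.\<close>

lemma sum_wG_le: "sum wG E \<le> (2 * \<beta> * c * (real k + 4) + 3 * \<gamma>) * (real n * \<Delta> * ln (real n))"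
proof -
  let ?N = "near_edges n L" and ?C = "connector_edges n b"
  have b: "0 < real b" using b_bounds by simp
  have fin: "finite ?N" "finite ?C" by (simp_all add: finite_near_edges finite_connector_edges)
  have "sum wG E = sum wG ?N + sum wG (?C - ?N)"
    unfolding E_def using fin by (subst sum.union_disjoint[symmetric]) (auto intro: arg_cong[where f = "sum wG"])
  also have "\<dots> = real (card ?N) + p * real (card (?C - ?N))" by (simp add: wG_def mult.commute)
  also have "\<dots> \<le> real (n * L) + p * real (card (block_graph n b) * (b * b))"
  proof (intro add_mono mult_left_mono p_bounds)
    show "real (card ?N) \<le> real (n * L)" using card_near_edges_le by (simp only: of_nat_le_iff)
    have "card (?C - ?N) \<le> card ?C" using fin by (intro card_mono) auto
    then show "real (card (?C - ?N)) \<le> real (card (block_graph n b) * (b * b))"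
      using card_connector_edges_le[of n b] by (simp only: of_nat_le_iff)
  qed
  also have "real (n * L) \<le> real n * ((real k + 4) * (2 * (\<beta> * c * \<Delta> * ln (real n))))"
  proof -
    have "real L = (real k + 4) * real b" by (simp add: L_def clique_range_def)
    also have "\<dots> \<le> (real k + 4) * (2 * (\<beta> * c * \<Delta> * ln (real n)))"
      using b_bounds by (intro mult_left_mono) auto
    finally show ?thesis by (simp add: mult_left_mono)
  qed
  also have "p * real (card (block_graph n b) * (b * b)) \<le> 3 * \<gamma> * (real n * \<Delta> * ln (real n))"
  proof -
    obtain r where r: "n < 2 ^ r" "real r \<le> 3 * ln (real n)" using two_power_log_bound[OF n] .
    define N where "N = num_blocks n b"
    have "real n / real b \<le> real n" using b_bounds(3) b mult_left_mono[of 1 "real b" "real n"] by (simp add: pos_divide_le_eq)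
    moreover have "0 \<le> real n / real b" by simp
    \<comment> \<open>The bound for the median graph involves one less than the number of blocks,
      which absorbs the rounding up of \<open>n / b\<close>.\<close>
    ultimately have N: "N \<le> n" "real (N - 1) \<le> real n / real b"
      unfolding N_def num_blocks_def by linarith+
    have "card (block_graph n b) \<le> r * (N + 1 - 1 - 1)"
      unfolding block_graph_def N_def[symmetric] by (rule card_median_graph_le) (use N r in auto)
    then have "real (card (block_graph n b)) \<le> real (r * (N - 1))" by (simp only: of_nat_le_iff) simp
    also have "\<dots> \<le> 3 * ln (real n) * (real n / real b)"
      unfolding of_nat_mult using r N ln_n by (intro mult_mono) auto
    finally have "p * real (card (block_graph n b) * (b * b)) \<le> p * (3 * ln (real n) * (real n / real b) * (real b * real b))"
      unfolding of_nat_mult using p_bounds by (intro mult_left_mono mult_right_mono) auto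
    also have "\<dots> = 3 * \<gamma> * (real n * \<Delta> * ln (real n))" using b by (simp add: p_eq)
    finally show ?thesis .
  qed
  finally show ?thesis by (simp add: algebra_simps)
qed

lemma random_G_few_edges:
  assumes "0 \<le> d"
  shows "1 - 1 / real n powr d \<le> measure_pmf.prob (random_G n k \<psi> c \<beta> \<gamma>)
    {G. real (card G) \<le> 2 * (2 * \<beta> * c * (real k + 4) + 3 * \<gamma> + d) *
      (real n / \<psi> powr (1 + 1 / (real k - 1)) * ln (real n))}"
proof -
  define K where "K = 2 * \<beta> * c * (real k + 4) + 3 * \<gamma>"
  define Q where "Q = real n * \<Delta> * ln (real n)"
  \<comment> \<open>The factor 2 makes up for \<open>ln 2\<close>, using
    \<open>ln 2 \<ge> 1 / 2\<close>; the part \<open>d * Q \<ge> d * ln n\<close> supplies the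
    probability \<open>1 / n powr d\<close>.\<close>
  let ?t = "2 * (K + d) * Q"
  have K: "0 \<le> K" using c_pos \<gamma> by (simp add: K_def)
  have "1 * 1 * ln (real n) \<le> Q" unfolding Q_def using n D_psi ln_n by (intro mult_mono) auto
  then have Q: "ln (real n) \<le> Q" "0 \<le> Q" using ln_n by auto
  have "measure_pmf.prob (random_edges E wG) {H. ?t < real (card H)} \<le> exp (sum wG E - ?t * ln 2)"
    by (rule prob_card_random_edges_gt) (use finite_E wG_bounds in auto)
  also have "\<dots> \<le> exp (- (d * ln (real n)))"
  proof -
    have "sum wG E \<le> K * Q" using sum_wG_le by (simp add: K_def Q_def)
    moreover have "?t * (1 / 2) \<le> ?t * ln 2"
      using K assms Q ln2_ge_two_thirds by (intro mult_left_mono) auto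
    moreover have "d * ln (real n) \<le> d * Q" using Q assms by (intro mult_left_mono) auto
    ultimately have "sum wG E - ?t * ln 2 \<le> - (d * ln (real n))" by (simp add: algebra_simps)
    then show ?thesis by simp
  qed
  also have "\<dots> = 1 / real n powr d" using n by (simp add: powr_def exp_minus divide_simps)
  finally have "measure_pmf.prob (random_edges E wG) {H. \<not> real (card H) \<le> ?t} \<le> 1 / real n powr d"
    by (simp add: not_le)
  then show ?thesis
    unfolding prob_Collect_not random_G divide_psi_powr Q_def K_def by simp
qed

lemma random_H_path_whp:
  assumes ij: "1 \<le> i" "j \<le> n" and d: "0 \<le> d"
    and cd: "d + 2 \<le> (min 1 (\<gamma> / 4))\<^sup>2 * (\<beta> * c / 4)"
    and far: "16 * (2 * d + 9) * (\<psi> powr (- 1 - 1 / (real k - 1)) * ln (real n)) < real j - real i"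
  shows "1 - 1 / real n powr d \<le> measure_pmf.prob (random_H n k \<psi> c \<beta> \<gamma>) {H. has_straight_path H k i j}"
proof -
  have "no_path i j \<le> 1 / real n powr d"
  proof (cases "j - i \<le> L")
    case True
    then show ?thesis using near_pair_whp[OF ij True d] far psi_powr by simp
  next
    case False
    then show ?thesis using ij d cd by (intro far_pair) auto
  qed
  then show ?thesis unfolding random_H prob_Collect_not by simp
qed

lemma expectation_bad_pairs:
  "measure_pmf.expectation (random_H n k \<psi> c \<beta> \<gamma>) (\<lambda>H. real (card (bad_pairs n H k))) =
    (\<Sum>i\<in>{1..n}. \<Sum>j\<in>{i<..n}. no_path i j)"
proof -
  have "real (card (bad_pairs n H k)) = (\<Sum>i\<in>{1..n}. \<Sum>j\<in>{i<..n}. indicat_real {H. \<not> has_straight_path H k i j} H)" for H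
  proof -
    let ?P = "SIGMA i:{1..n}. {i<..n}"
    have "bad_pairs n H k = {x \<in> ?P. \<not> has_straight_path H k (fst x) (snd x)}"
      by (auto simp: bad_pairs_def)
    then have "real (card (bad_pairs n H k)) = (\<Sum>x\<in>?P. if \<not> has_straight_path H k (fst x) (snd x) then 1 else 0)"
      by (simp add: sum.If_cases Int_def)
    also have "\<dots> = (\<Sum>i\<in>{1..n}. \<Sum>j\<in>{i<..n}. indicat_real {H. \<not> has_straight_path H k i j} H)"
      by (subst sum.Sigma) (auto simp: indicator_def intro!: sum.cong)
    finally show ?thesis .
  qed
  then have "measure_pmf.expectation (random_H n k \<psi> c \<beta> \<gamma>) (\<lambda>H. real (card (bad_pairs n H k))) =
    measure_pmf.expectation (random_edges E w) (\<lambda>H. \<Sum>i\<in>{1..n}. \<Sum>j\<in>{i<..n}. indicat_real {H. \<not> has_straight_path H k i j} H)"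
    by (simp add: random_H)
  also have "\<dots> = (\<Sum>i\<in>{1..n}. \<Sum>j\<in>{i<..n}. no_path i j)"
    by (simp add: Bochner_Integration.integral_sum integrable_measure_pmf_finite finite_set_random_edges[OF finite_E])
  finally show ?thesis .
qed

text \<open>The decaying part contributes at most \<open>5 * Z\<close> for each \<open>i\<close>, in
  all \<open>85 * k * n * \<Delta>\<close>. The far pairs fail with probability at most
  \<open>1 / n ^ 2\<close> each and contribute at most 1, which is below
  \<open>k * n * \<Delta>\<close>.\<close>

lemma random_H_few_bad_pairs:
  assumes cd: "4 \<le> (min 1 (\<gamma> / 4))\<^sup>2 * (\<beta> * c / 4)"
  shows "measure_pmf.expectation (random_H n k \<psi> c \<beta> \<gamma>) (\<lambda>H. real (card (bad_pairs n H k)))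
    \<le> 86 * (real k * real n / \<psi> powr (1 + 1 / (real k - 1)))"
proof -
  define Z where "Z = 17 * real k * \<Delta>"
  have Z: "0 < Z" using k D_psi by (simp add: Z_def)
  have pair: "no_path i j \<le> 5 * exp (- (real (j - i) / Z)) + 1 / (real n)\<^sup>2" if ij: "1 \<le> i" "i < j" "j \<le> n" for i j
  proof (cases "j - i \<le> L")
    case True
    then show ?thesis using near_pair_exp[OF ij True] by (simp add: Z_def add_increasing2)
  next
    case False
    \<comment> \<open>The hypothesis \<open>cd\<close> is the condition for exponent 2.\<close>
    have "no_path i j \<le> 1 / real n powr 2"
      by (rule far_pair) (use ij False cd in auto)
    then show ?thesis using n by (simp add: add_increasing powr_realpow[of "real n" 2, simplified])
  qed
  have "(\<Sum>i\<in>{1..n}. \<Sum>j\<in>{i<..n}. no_path i j) \<le> (\<Sum>i\<in>{1..n}. 5 * Z + 1 / real n)"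
  proof (rule sum_mono)
    fix i assume i: "i \<in> {1..n}"
    have "(\<Sum>j\<in>{i<..n}. no_path i j) \<le> (\<Sum>j\<in>{i<..n}. 5 * exp (- (real (j - i) / Z)) + 1 / (real n)\<^sup>2)"
      using i by (intro sum_mono pair) auto
    also have "\<dots> = (\<Sum>l\<in>{1..n - i}. 5 * exp (- (real l / Z)) + 1 / (real n)\<^sup>2)"
      by (rule sum.reindex_bij_witness[of _ "\<lambda>l. l + i" "\<lambda>j. j - i"]) auto
    also have "\<dots> = 5 * (\<Sum>l\<in>{1..n - i}. exp (- (real l / Z))) + real (n - i) * (1 / (real n)\<^sup>2)"
      by (simp add: sum.distrib sum_distrib_left)
    also have "\<dots> \<le> 5 * Z + real n * (1 / (real n)\<^sup>2)"
      using sum_exp_neg_le[OF Z] by (intro add_mono mult_left_mono mult_right_mono) auto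
    finally show "(\<Sum>j\<in>{i<..n}. no_path i j) \<le> 5 * Z + 1 / real n" using n by (simp add: power2_eq_square)
  qed
  also have "\<dots> = real n * 5 * Z + 1" using n by (simp add: algebra_simps)
  also have "\<dots> \<le> real n * 5 * Z + real k * real n * \<Delta>"
  proof -
    have "1 * 1 * 1 \<le> real k * real n * \<Delta>" using k n D_psi by (intro mult_mono) auto
    then show ?thesis by simp
  qed
  also have "\<dots> = 86 * (real k * real n * \<Delta>)" by (simp add: Z_def algebra_simps)
  finally show ?thesis unfolding expectation_bad_pairs divide_psi_powr .
qed

end

theorem theorem5p13:
  fixes \<beta> \<gamma> d :: real
  assumes "\<beta> > 0" and "\<gamma> > 0" and "d > 0"
  shows "\<exists>c0>0. \<forall>c\<ge>c0.
    (\<forall>k>3. \<exists>C>0. \<forall>n>0. \<forall>\<psi>::real. 0 < \<psi> \<and> \<psi> < 1 \<longrightarrow>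
       measure_pmf.prob (random_G n k \<psi> c \<beta> \<gamma>)
         {G. real (card G) \<le> C * (real n / \<psi> powr (1 + 1 / (real k - 1)) * ln (real n))}
       \<ge> 1 - 1 / real n powr d) \<and>
    (\<exists>C>0. \<forall>k>3. \<forall>n>0. \<forall>\<psi>::real. 0 < \<psi> \<and> \<psi> < 1 \<longrightarrow>
       measure_pmf.expectation (random_H n k \<psi> c \<beta> \<gamma>) (\<lambda>H. real (card (bad_pairs n H k)))
       \<le> C * (real k * real n / \<psi> powr (1 + 1 / (real k - 1)))) \<and>
    (\<exists>A>0. \<forall>k>3. \<forall>n>0. \<forall>\<psi>::real. 0 < \<psi> \<and> \<psi> < 1 \<longrightarrow>
       (\<forall>i\<in>{1..n}. \<forall>j\<in>{1..n}.
          real j > real i + A * (\<psi> powr (- 1 - 1 / (real k - 1)) * ln (real n)) \<longrightarrow>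
          measure_pmf.prob (random_H n k \<psi> c \<beta> \<gamma>) {H. has_straight_path H k i j}
          \<ge> 1 - 1 / real n powr d))"
proof -
  define \<kappa> where "\<kappa> = (min 1 (\<gamma> / 4))\<^sup>2"
  \<comment> \<open>The first summand yields \<open>1 + \<gamma> \<le> \<beta> * c * ln 2\<close>,
    hence both conditions on \<open>c\<close> in the locale. The second yields
    \<open>d + 4 \<le> \<kappa> * (\<beta> * c / 4)\<close>, which covers \<open>d + 2\<close> for
    single pairs and 4 for the expectation.\<close>
  define c0 where "c0 = (1 + \<gamma>) / (\<beta> * ln 2) + 4 * (d + 4) / (\<beta> * \<kappa>)"
  have \<kappa>: "0 < \<kappa>" using assms by (simp add: \<kappa>_def)
  have pos: "0 < (1 + \<gamma>) / (\<beta> * ln 2)" "0 < 4 * (d + 4) / (\<beta> * \<kappa>)"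
    using assms \<kappa> by simp_all
  show ?thesis
  proof (rule exI[of _ c0], intro conjI allI impI)
    show "0 < c0" using pos by (simp add: c0_def)
  next
    fix c assume c: "c0 \<le> c"
    have "(1 + \<gamma>) / (\<beta> * ln 2) \<le> c" "4 * (d + 4) / (\<beta> * \<kappa>) \<le> c" using c pos by (simp_all add: c0_def)
    then have c1: "1 + \<gamma> \<le> \<beta> * c * ln 2" and c2: "d + 4 \<le> \<kappa> * (\<beta> * c / 4)"
      using assms \<kappa> by (simp_all add: pos_divide_le_eq mult_ac)
    have params: "spanner_params n k \<psi> c \<beta> \<gamma>" if "3 < k" "n > 0" "n \<noteq> 1" "0 < \<psi> \<and> \<psi> < 1" for n k \<psi>
      by unfold_locales (use that assms c1 in auto)
    have c_nonneg: "0 \<le> c" using c pos by (simp add: c0_def)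
    show "\<exists>C>0. \<forall>n>0. \<forall>\<psi>::real. 0 < \<psi> \<and> \<psi> < 1 \<longrightarrow>
       measure_pmf.prob (random_G n k \<psi> c \<beta> \<gamma>)
         {G. real (card G) \<le> C * (real n / \<psi> powr (1 + 1 / (real k - 1)) * ln (real n))}
       \<ge> 1 - 1 / real n powr d" if "3 < k" for k
    proof (rule exI[of _ "2 * (2 * \<beta> * c * (real k + 4) + 3 * \<gamma> + d)"], intro conjI allI impI)
      show "0 < 2 * (2 * \<beta> * c * (real k + 4) + 3 * \<gamma> + d)"
        using assms c_nonneg by (simp add: add_nonneg_pos)
      fix n :: nat and \<psi> :: real assume "n > 0" "0 < \<psi> \<and> \<psi> < 1"
      \<comment> \<open>For \<open>n = 1\<close> the lower bound is 0.\<close>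
      then show "1 - 1 / real n powr d \<le> measure_pmf.prob (random_G n k \<psi> c \<beta> \<gamma>)
         {G. real (card G) \<le> 2 * (2 * \<beta> * c * (real k + 4) + 3 * \<gamma> + d) *
           (real n / \<psi> powr (1 + 1 / (real k - 1)) * ln (real n))}"
        using spanner_params.random_G_few_edges[OF params, of k n \<psi> d] that assms by (cases "n = 1") auto
    qed
    show "\<exists>C>0. \<forall>k>3. \<forall>n>0. \<forall>\<psi>::real. 0 < \<psi> \<and> \<psi> < 1 \<longrightarrow>
       measure_pmf.expectation (random_H n k \<psi> c \<beta> \<gamma>) (\<lambda>H. real (card (bad_pairs n H k)))
       \<le> C * (real k * real n / \<psi> powr (1 + 1 / (real k - 1)))"
    proof (rule exI[of _ 86], intro conjI allI impI)
      fix k n :: nat and \<psi> :: real assume *: "3 < k" "n > 0" "0 < \<psi> \<and> \<psi> < 1"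
      show "measure_pmf.expectation (random_H n k \<psi> c \<beta> \<gamma>) (\<lambda>H. real (card (bad_pairs n H k)))
         \<le> 86 * (real k * real n / \<psi> powr (1 + 1 / (real k - 1)))"
      proof (cases "n = 1")
        case True
        then have "bad_pairs n H k = {}" for H by (auto simp: bad_pairs_def)
        then show ?thesis by simp
      next
        case False
        show ?thesis
          by (rule spanner_params.random_H_few_bad_pairs[OF params]) (use * False c2 assms in \<open>simp_all add: \<kappa>_def\<close>)
      qed
    qed simp
    show "\<exists>A>0. \<forall>k>3. \<forall>n>0. \<forall>\<psi>::real. 0 < \<psi> \<and> \<psi> < 1 \<longrightarrow>
       (\<forall>i\<in>{1..n}. \<forall>j\<in>{1..n}.
          real j > real i + A * (\<psi> powr (- 1 - 1 / (real k - 1)) * ln (real n)) \<longrightarrow>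
          measure_pmf.prob (random_H n k \<psi> c \<beta> \<gamma>) {H. has_straight_path H k i j}
          \<ge> 1 - 1 / real n powr d)"
    proof (rule exI[of _ "16 * (2 * d + 9)"], intro conjI allI impI ballI)
      show "0 < 16 * (2 * d + 9)" using assms by simp
      fix k n i j :: nat and \<psi> :: real
      assume *: "3 < k" "n > 0" "0 < \<psi> \<and> \<psi> < 1" "i \<in> {1..n}" "j \<in> {1..n}"
        "real i + 16 * (2 * d + 9) * (\<psi> powr (- 1 - 1 / (real k - 1)) * ln (real n)) < real j"
      show "1 - 1 / real n powr d \<le> measure_pmf.prob (random_H n k \<psi> c \<beta> \<gamma>) {H. has_straight_path H k i j}"
      proof (cases "n = 1")
        case False
        show ?thesis
          by (rule spanner_params.random_H_path_whp[OF params]) (use * False c2 assms in \<open>simp_all add: \<kappa>_def\<close>)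
      qed simp
    qed
  qed
qed

end
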